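(* Let $C_1,\dots,C_n$ be independent first class constraints on $\mathcal{M}$, let $T_1,\dots,T_n\in C^\infty(\mathcal{M})$, and let $U$ be an open neighbourhood of the constraint hypersurface $\mathcal{C}$ on which the matrix $A_{jk}:=\{C_j,T_k\}$ is invertible. Define on $U$ the new constraints $\tilde C_m:=\sum_jA^{-1}_{mj}C_j$, $m=1,\dots,n$. Then: (i) the set $\{\tilde C_1,\dots,\tilde C_n\}$ is weakly abelian: the Poisson brackets $\{\tilde C_m,\tilde C_j\}$ contain only terms at least quadratic in the constraints, i.e. there are $c_{mjkl}\in C^\infty(U)$ with $\{\tilde C_m,\tilde C_j\}=\sum_{k,l}c_{mjkl}\,\tilde C_k\tilde C_l$ on $U$; (ii) the clock variables evolve linearly on $\mathcal{C}$: for $\beta\in\mathbb{R}^n$, $x\in\mathcal{C}$ and $k=1,\dots,n$, $$T_k(\alpha_{\beta_j\tilde C_j}(x))=T_k(x)+\beta_k$$ whenever the flow is defined.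
   Context: $\mathcal{M}$ is a $2p$-dimensional smooth manifold with a non-degenerate Poisson bracket $\{\cdot,\cdot\}$. The constraints $C_1,\dots,C_n\in C^\infty(\mathcal{M})$, $n<p$, are independent, meaning that the constraint hypersurface $\mathcal{C}=\{C_1=\dots=C_n=0\}$ is a $(2p-n)$-dimensional submanifold, and first class: $\{C_i,C_j\}=\sum_k f_{ijk}C_k$ with $f_{ijk}\in C^\infty(\mathcal{M})$. For a function $H$ the Hamiltonian vector field is $\chi_H(f)=\{H,f\}$, with flow $\alpha_H^t$; $\alpha_{\beta_j\tilde C_j}$ denotes the flow of $\sum_j\beta_j\tilde C_j$ at parameter $t=1$. *)

theory Defs
  imports "HOL-Analysis.Analysis"
begin

section \<open>Smooth functions on open subsets of Euclidean spaces\<close>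

text \<open>Intended for open \<open>S\<close>: \<open>f\<close> is differentiable and all its directional derivatives are
  \<open>C\<^sup>k\<close>; on Euclidean spaces this is the usual \<open>C\<^sup>k\<^sup>+\<^sup>1\<close>.\<close>

primrec Ck_on ::
  "nat \<Rightarrow> 'e::euclidean_space set \<Rightarrow> ('e \<Rightarrow> 'b::real_normed_vector) \<Rightarrow> bool" where
  "Ck_on 0 S f \<longleftrightarrow> continuous_on S f"
| "Ck_on (Suc k) S f \<longleftrightarrow> (\<forall>x\<in>S. f differentiable (at x)) \<and>
     (\<forall>v. Ck_on k S (\<lambda>x. frechet_derivative f (at x) v))"

definition Cinf_on :: "'e::euclidean_space set \<Rightarrow> ('e \<Rightarrow> 'b::real_normed_vector) \<Rightarrow> bool" where
  "Cinf_on S f \<longleftrightarrow> (\<forall>k. Ck_on k S f)"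

section \<open>Smooth manifolds\<close>

text \<open>The underlying space of the manifold is a whole Hausdorff, second countable type \<open>'a\<close>; its
  dimension is that of the model space \<open>'e\<close>.\<close>

type_synonym ('a, 'e) chart = "'a set \<times> ('a \<Rightarrow> 'e)"

definition is_chart :: "('a::topological_space, 'e::euclidean_space) chart \<Rightarrow> bool" where
  "is_chart = (\<lambda>(V, \<phi>). open V \<and> open (\<phi> ` V) \<and> homeomorphism V (\<phi> ` V) \<phi> (inv_into V \<phi>))"

definition smooth_transition ::
  "('a::topological_space, 'e::euclidean_space) chart \<Rightarrow> ('a, 'e) chart \<Rightarrow> bool" where
  "smooth_transition = (\<lambda>(V, \<phi>) (W, \<psi>). Cinf_on (\<phi> ` (V \<inter> W)) (\<psi> \<circ> inv_into V \<phi>))"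

definition smooth_manifold ::
  "('a::{t2_space, second_countable_topology}, 'e::euclidean_space) chart set \<Rightarrow> bool" where
  "smooth_manifold A \<longleftrightarrow> (\<forall>c\<in>A. is_chart c) \<and> (\<Union>c\<in>A. fst c) = UNIV \<and>
     (\<forall>c\<in>A. \<forall>d\<in>A. smooth_transition c d)"

definition compatible_chart ::
  "('a::topological_space, 'e::euclidean_space) chart set \<Rightarrow> ('a, 'e) chart \<Rightarrow> bool" where
  "compatible_chart A c \<longleftrightarrow> is_chart c \<and> (\<forall>d\<in>A. smooth_transition c d \<and> smooth_transition d c)"

text \<open>\<open>smooth_funs A U\<close> is \<open>C\<^sup>\<infinity>(U)\<close> for open \<open>U\<close>. Its elements are total functions, whose values
  outside \<open>U\<close> are unconstrained.\<close>

definition smooth_funs ::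
  "('a::topological_space, 'e::euclidean_space) chart set \<Rightarrow> 'a set \<Rightarrow> ('a \<Rightarrow> real) set" where
  "smooth_funs A U = {f. \<forall>(V, \<phi>)\<in>A. Cinf_on (\<phi> ` (U \<inter> V)) (f \<circ> inv_into V \<phi>)}"

definition zero_differential ::
  "('a::topological_space, 'e::euclidean_space) chart set \<Rightarrow> ('a \<Rightarrow> real) \<Rightarrow> 'a \<Rightarrow> bool" where
  "zero_differential A f x \<longleftrightarrow>
     (\<forall>(V, \<phi>)\<in>A. x \<in> V \<longrightarrow> ((f \<circ> inv_into V \<phi>) has_derivative (\<lambda>_. 0)) (at (\<phi> x)))"

text \<open>Embedded submanifolds, by slice charts from the maximal atlas.\<close>

definition submanifold ::
  "('a::topological_space, 'e::euclidean_space) chart set \<Rightarrow> nat \<Rightarrow> 'a set \<Rightarrow> bool" where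
  "submanifold A d S \<longleftrightarrow> (\<forall>x\<in>S. \<exists>V \<phi> L. compatible_chart A (V, \<phi>) \<and> x \<in> V \<and>
     subspace L \<and> dim L = d \<and> \<phi> ` (V \<inter> S) = \<phi> ` V \<inter> L)"

section \<open>Poisson brackets\<close>

definition poisson_bracket ::
  "('a::topological_space, 'e::euclidean_space) chart set \<Rightarrow>
     (('a \<Rightarrow> real) \<Rightarrow> ('a \<Rightarrow> real) \<Rightarrow> 'a \<Rightarrow> real) \<Rightarrow> bool" where
  "poisson_bracket A br \<longleftrightarrow>
     (let F = smooth_funs A UNIV in
       (\<forall>f\<in>F. \<forall>g\<in>F. br f g \<in> F) \<and>
       (\<forall>f\<in>F. \<forall>g\<in>F. \<forall>x. br f g x = - br g f x) \<and>
       (\<forall>f\<in>F. \<forall>g\<in>F. \<forall>h\<in>F. \<forall>a b x.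
          br (\<lambda>y. a * f y + b * g y) h x = a * br f h x + b * br g h x) \<and>
       (\<forall>f\<in>F. \<forall>g\<in>F. \<forall>h\<in>F. \<forall>x.
          br (\<lambda>y. f y * g y) h x = f x * br g h x + br f h x * g x) \<and>
       (\<forall>f\<in>F. \<forall>g\<in>F. \<forall>h\<in>F. \<forall>x.
          br f (br g h) x + br g (br h f) x + br h (br f g) x = 0))"

text \<open>Injectivity of \<open>df\<^sub>x \<mapsto> {f, \<cdot>}(x)\<close> on every cotangent space.\<close>

definition nondegenerate ::
  "('a::topological_space, 'e::euclidean_space) chart set \<Rightarrow>
     (('a \<Rightarrow> real) \<Rightarrow> ('a \<Rightarrow> real) \<Rightarrow> 'a \<Rightarrow> real) \<Rightarrow> bool" where
  "nondegenerate A br \<longleftrightarrow> (\<forall>x. \<forall>f\<in>smooth_funs A UNIV.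
     (\<forall>g\<in>smooth_funs A UNIV. br f g x = 0) \<longrightarrow> zero_differential A f x)"

text \<open>A Poisson bracket is local, so it restricts to functions that are smooth only on an open set:
  the value at \<open>x\<close> is computed from any global smooth functions with the same germs at \<open>x\<close>.\<close>

definition local_bracket ::
  "('a::topological_space, 'e::euclidean_space) chart set \<Rightarrow>
     (('a \<Rightarrow> real) \<Rightarrow> ('a \<Rightarrow> real) \<Rightarrow> 'a \<Rightarrow> real) \<Rightarrow> ('a \<Rightarrow> real) \<Rightarrow> ('a \<Rightarrow> real) \<Rightarrow> 'a \<Rightarrow> real" where
  "local_bracket A br f g x = (THE c. \<exists>F\<in>smooth_funs A UNIV. \<exists>G\<in>smooth_funs A UNIV.
     (\<forall>\<^sub>F y in nhds x. F y = f y \<and> G y = g y) \<and> c = br F G x)"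

definition ham_vf ::
  "('a::topological_space, 'e::euclidean_space) chart set \<Rightarrow>
     (('a \<Rightarrow> real) \<Rightarrow> ('a \<Rightarrow> real) \<Rightarrow> 'a \<Rightarrow> real) \<Rightarrow> ('a \<Rightarrow> real) \<Rightarrow> ('a \<Rightarrow> real) \<Rightarrow> 'a \<Rightarrow> real" where
  "ham_vf A br H f = local_bracket A br H f"

text \<open>Integral curves in the open set \<open>U\<close>, with tangent vectors acting as derivations on
  \<open>C\<^sup>\<infinity>(U)\<close>.\<close>

definition integral_curve ::
  "('a::topological_space, 'e::euclidean_space) chart set \<Rightarrow>
     (('a \<Rightarrow> real) \<Rightarrow> ('a \<Rightarrow> real) \<Rightarrow> 'a \<Rightarrow> real) \<Rightarrow> 'a set \<Rightarrow> ('a \<Rightarrow> real) \<Rightarrow>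
     real set \<Rightarrow> (real \<Rightarrow> 'a) \<Rightarrow> bool" where
  "integral_curve A br U H I \<gamma> \<longleftrightarrow> continuous_on I \<gamma> \<and> \<gamma> ` I \<subseteq> U \<and>
     (\<forall>f\<in>smooth_funs A U. \<forall>t\<in>I.
        ((\<lambda>s. f (\<gamma> s)) has_real_derivative ham_vf A br H f (\<gamma> t)) (at t within I))"

text \<open>The graph of the flow of \<open>H\<close> on \<open>U\<close>: \<open>ham_flow A br U H t x y\<close> says that
  \<open>\<alpha>\<^sub>H\<^sup>t(x)\<close> is defined and equal to \<open>y\<close>.\<close>

definition ham_flow ::
  "('a::topological_space, 'e::euclidean_space) chart set \<Rightarrow>
     (('a \<Rightarrow> real) \<Rightarrow> ('a \<Rightarrow> real) \<Rightarrow> 'a \<Rightarrow> real) \<Rightarrow> 'a set \<Rightarrow> ('a \<Rightarrow> real) \<Rightarrow>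
     real \<Rightarrow> 'a \<Rightarrow> 'a \<Rightarrow> bool" where
  "ham_flow A br U H t x y \<longleftrightarrow>
     (\<exists>\<gamma>. integral_curve A br U H (closed_segment 0 t) \<gamma> \<and> \<gamma> 0 = x \<and> \<gamma> t = y)"

section \<open>Constraints\<close>

definition constraint_surface :: "('n \<Rightarrow> 'a \<Rightarrow> real) \<Rightarrow> 'a set" where
  "constraint_surface C = {x. \<forall>i. C i x = 0}"

definition independent_constraints ::
  "('a::topological_space, 'e::euclidean_space) chart set \<Rightarrow> ('n::finite \<Rightarrow> 'a \<Rightarrow> real) \<Rightarrow> bool" where
  "independent_constraints A C \<longleftrightarrow> submanifold A (DIM('e) - CARD('n)) (constraint_surface C)"

definition first_class ::
  "('a::topological_space, 'e::euclidean_space) chart set \<Rightarrow>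
     (('a \<Rightarrow> real) \<Rightarrow> ('a \<Rightarrow> real) \<Rightarrow> 'a \<Rightarrow> real) \<Rightarrow> ('n::finite \<Rightarrow> 'a \<Rightarrow> real) \<Rightarrow> bool" where
  "first_class A br C \<longleftrightarrow> (\<exists>f. (\<forall>i j k. f i j k \<in> smooth_funs A UNIV) \<and>
     (\<forall>i j x. br (C i) (C j) x = (\<Sum>k\<in>UNIV. f i j k x * C k x)))"

definition clock_matrix ::
  "(('a \<Rightarrow> real) \<Rightarrow> ('a \<Rightarrow> real) \<Rightarrow> 'a \<Rightarrow> real) \<Rightarrow> ('n::finite \<Rightarrow> 'a \<Rightarrow> real) \<Rightarrow>
     ('n \<Rightarrow> 'a \<Rightarrow> real) \<Rightarrow> 'a \<Rightarrow> real^'n^'n" where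
  "clock_matrix br C T x = (\<chi> j k. br (C j) (T k) x)"

definition new_constraint ::
  "(('a \<Rightarrow> real) \<Rightarrow> ('a \<Rightarrow> real) \<Rightarrow> 'a \<Rightarrow> real) \<Rightarrow> ('n::finite \<Rightarrow> 'a \<Rightarrow> real) \<Rightarrow>
     ('n \<Rightarrow> 'a \<Rightarrow> real) \<Rightarrow> 'n \<Rightarrow> 'a \<Rightarrow> real" where
  "new_constraint br C T m x = (\<Sum>j\<in>UNIV. matrix_inv (clock_matrix br C T x) $ m $ j * C j x)"

end

theory Submission
  imports Defs
begin

text \<open>Write \<open>N = A\<^sup>-\<^sup>1\<close>. In \<open>{N\<^sub>m\<^sub>a C\<^sub>a, N\<^sub>j\<^sub>b C\<^sub>b}\<close> the brackets with one factor \<open>N\<close> are rewritten by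
  \<open>{C\<^sub>a, N} = - N {C\<^sub>a, A} N\<close>; the Jacobi identity turns the antisymmetrised double brackets
  \<open>{C\<^sub>a, {C\<^sub>b, T\<^sub>d}}\<close> into \<open>{{C\<^sub>a, C\<^sub>b}, T\<^sub>d}\<close>, and inserting the first class relations cancels
  \<open>{C\<^sub>a, C\<^sub>b}\<close> up to terms quadratic in the constraints. For the flow, the first class relations make
  \<open>t \<mapsto> C\<^sub>m(\<gamma>(t))\<close> a solution of a linear ODE with zero initial value, so the integral curve stays on the
  constraint surface, where \<open>{\<beta>\<^sub>j N\<^sub>j\<^sub>a C\<^sub>a, T\<^sub>k} = \<beta>\<^sub>j N\<^sub>j\<^sub>a A\<^sub>a\<^sub>k = \<beta>\<^sub>k\<close>. Bump functions give meaning
  to brackets of functions that are smooth only on \<open>U\<close>.\<close>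

section \<open>Calculus of \<open>C\<^sup>k\<close> functions\<close>

text \<open>\<open>frechet_derivative\<close> is a choice among all derivatives, so it suffices that
  both functions satisfy the same derivative predicate for every \<open>D\<close>. No
  differentiability is assumed, which lets congruence of \<open>Ck_on\<close> go through by plain
  induction.\<close>

lemma frechet_derivative_cong_open:
  assumes "open S" "x \<in> S" "\<And>y. y \<in> S \<Longrightarrow> f y = g y"
  shows "frechet_derivative f (at x) = frechet_derivative g (at x)"
proof -
  have "(f has_derivative D) (at x) \<longleftrightarrow> (g has_derivative D) (at x)" for D
    using assms has_derivative_transform_within_open[OF _ assms(1,2)] by metis
  then show ?thesis
    unfolding frechet_derivative_def by simp
qed

lemma differentiable_cong_open:
  assumes "open S" "x \<in> S" "\<And>y. y \<in> S \<Longrightarrow> f y = g y"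
  shows "f differentiable (at x) \<longleftrightarrow> g differentiable (at x)"
  using assms has_derivative_transform_within_open[OF _ assms(1,2)]
  unfolding differentiable_def by metis

lemma Ck_on_cong:
  assumes "open S" "\<And>y. y \<in> S \<Longrightarrow> f y = g y"
  shows "Ck_on k S f \<longleftrightarrow> Ck_on k S g"
  using assms
proof (induction k arbitrary: f g)
  case 0
  then show ?case by (auto cong: continuous_on_cong)
next
  case (Suc k)
  have "Ck_on k S (\<lambda>x. frechet_derivative f (at x) v) \<longleftrightarrow> Ck_on k S (\<lambda>x. frechet_derivative g (at x) v)" for v
    using Suc.prems frechet_derivative_cong_open[of S _ f g] by (intro Suc.IH) auto
  then show ?case
    using Suc.prems differentiable_cong_open[of S _ f g] by auto
qed

lemma Ck_on_transform:
  assumes "open S" "Ck_on k S f" "\<And>y. y \<in> S \<Longrightarrow> f y = g y"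
  shows "Ck_on k S g"
  using Ck_on_cong[of S f g] assms by simp

lemma Ck_on_subset: "Ck_on k S f \<Longrightarrow> T \<subseteq> S \<Longrightarrow> Ck_on k T f"
  by (induction k arbitrary: f) (auto intro: continuous_on_subset)

lemma Ck_on_SucD: "Ck_on (Suc k) S f \<Longrightarrow> Ck_on k S f"
proof (induction k arbitrary: f)
  case 0
  then show ?case
    by (auto intro!: continuous_at_imp_continuous_on differentiable_imp_continuous_within)
next
  case (Suc k)
  then show ?case by (metis Ck_on.simps(2))
qed

text \<open>The gluing principle: a function assembled from pieces, such as a cut-off function
  extended by zero, is tested near one point at a time.\<close>

lemma Ck_on_locally:
  assumes "\<And>x. x \<in> S \<Longrightarrow> \<exists>T. open T \<and> x \<in> T \<and> Ck_on k T f"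
  shows "Ck_on k S f"
  using assms
proof (induction k arbitrary: f)
  case 0
  show ?case
    unfolding Ck_on.simps
  proof (rule continuous_at_imp_continuous_on, rule ballI)
    fix x assume "x \<in> S"
    then obtain T where "open T" "x \<in> T" "continuous_on T f" using 0[of x] by auto
    then show "continuous (at x) f" by (simp add: continuous_on_eq_continuous_at)
  qed
next
  case (Suc k)
  have "f differentiable (at x)" if "x \<in> S" for x
    using Suc.prems[OF that] by auto
  moreover have "Ck_on k S (\<lambda>x. frechet_derivative f (at x) v)" for v
    using Suc.prems by (intro Suc.IH) fastforce
  ultimately show ?case by simp
qed

text \<open>An explicit derivative formula \<open>D\<close> stands in for the choice made by
  \<open>frechet_derivative\<close>. The closure proofs that follow differentiate by a known rule
  and then apply induction to the formula.\<close>

lemma Ck_on_Suc_intro: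
  assumes "open S" and "\<And>x. x \<in> S \<Longrightarrow> (f has_derivative D x) (at x)"
    and "\<And>v. Ck_on k S (\<lambda>x. D x v)"
  shows "Ck_on (Suc k) S f"
proof -
  have "frechet_derivative f (at x) = D x" if "x \<in> S" for x
    using frechet_derivative_at[OF assms(2)[OF that]] by simp
  then have "Ck_on k S (\<lambda>x. frechet_derivative f (at x) v)" for v
    using Ck_on_cong[OF assms(1), of "\<lambda>x. frechet_derivative f (at x) v" "\<lambda>x. D x v"] assms(3)
    by auto
  then show ?thesis
    using assms(2) by (auto simp: differentiable_def)
qed

lemma Ck_on_Suc_deriv:
  assumes "Ck_on (Suc k) S f" "x \<in> S"
  shows "(f has_derivative frechet_derivative f (at x)) (at x)"
  using assms by (simp add: frechet_derivative_works)

section \<open>Closure of \<open>Ck_on\<close> under algebraic operations and composition\<close>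

lemma Ck_on_const: "open S \<Longrightarrow> Ck_on k S (\<lambda>x. c)"
proof (induction k arbitrary: c)
  case (Suc k)
  then show ?case
    by (intro Ck_on_Suc_intro[where D="\<lambda>x v. 0"]) auto
qed auto

lemma Ck_on_ident: "open S \<Longrightarrow> Ck_on k S (\<lambda>x. x)"
proof (cases k)
  case (Suc k')
  moreover assume "open S"
  ultimately show ?thesis
    by (auto intro!: Ck_on_Suc_intro[where D="\<lambda>x v. v"] Ck_on_const simp del: Ck_on.simps)
qed auto

lemma Ck_on_add:
  assumes "open S" "Ck_on k S f" "Ck_on k S g"
  shows "Ck_on k S (\<lambda>x. f x + g x)"
  using assms
proof (induction k arbitrary: f g)
  case 0
  then show ?case by (auto intro: continuous_on_add)
next
  case (Suc k)
  show ?case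
  proof (rule Ck_on_Suc_intro[OF Suc.prems(1)])
    show "((\<lambda>x. f x + g x) has_derivative
        (\<lambda>v. frechet_derivative f (at x) v + frechet_derivative g (at x) v)) (at x)" if "x \<in> S" for x
      using Suc.prems that by (intro has_derivative_add Ck_on_Suc_deriv)
  qed (use Suc in auto)
qed

lemma Ck_on_bounded_linear:
  assumes "bounded_linear L" "open S" "Ck_on k S f"
  shows "Ck_on k S (\<lambda>x. L (f x))"
  using assms(2,3)
proof (induction k arbitrary: f)
  case 0
  then show ?case
    using assms(1) by (auto intro: bounded_linear.continuous_on)
next
  case (Suc k)
  show ?case
  proof (rule Ck_on_Suc_intro[OF Suc.prems(1)])
    show "((\<lambda>x. L (f x)) has_derivative (\<lambda>v. L (frechet_derivative f (at x) v))) (at x)" if "x \<in> S" for x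
      using Suc.prems that by (intro bounded_linear.has_derivative[OF assms(1)] Ck_on_Suc_deriv)
  qed (use Suc in auto)
qed

lemma Ck_on_mult:
  fixes f g :: "'e::euclidean_space \<Rightarrow> real"
  assumes "open S" "Ck_on k S f" "Ck_on k S g"
  shows "Ck_on k S (\<lambda>x. f x * g x)"
  using assms
proof (induction k arbitrary: f g)
  case 0
  then show ?case by (auto intro: continuous_on_mult)
next
  case (Suc k)
  show ?case
  proof (rule Ck_on_Suc_intro[OF Suc.prems(1)])
    show "((\<lambda>x. f x * g x) has_derivative
        (\<lambda>v. f x * frechet_derivative g (at x) v + frechet_derivative f (at x) v * g x)) (at x)"
      if "x \<in> S" for x
      using Suc.prems that by (intro has_derivative_mult Ck_on_Suc_deriv)
    show "Ck_on k S (\<lambda>x. f x * frechet_derivative g (at x) v + frechet_derivative f (at x) v * g x)"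
      for v
      \<comment> \<open>The product rule leaves one factor undifferentiated, so that factor must be
        lowered from order \<open>Suc k\<close> to \<open>k\<close>.\<close>
      using Suc.prems Ck_on_SucD[of k S f] Ck_on_SucD[of k S g]
      by (intro Ck_on_add Suc.IH) auto
  qed
qed

lemma Ck_on_sum:
  assumes "open S" "\<And>i. i \<in> I \<Longrightarrow> Ck_on k S (f i)"
  shows "Ck_on k S (\<lambda>x. \<Sum>i\<in>I. f i x)"
  using assms(2)
  by (induction I rule: infinite_finite_induct) (auto intro: Ck_on_const Ck_on_add assms(1))

text \<open>The derivative of \<open>1/f\<close> is a product of \<open>1/f\<close> and a derivative
  of \<open>f\<close>, so the induction hypothesis one order lower supplies every factor.\<close>

lemma Ck_on_inverse:
  fixes f :: "'e::euclidean_space \<Rightarrow> real"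
  assumes "open S" "Ck_on k S f" "\<And>x. x \<in> S \<Longrightarrow> f x \<noteq> 0"
  shows "Ck_on k S (\<lambda>x. inverse (f x))"
  using assms
proof (induction k)
  case 0
  then show ?case by (auto intro: continuous_on_inverse)
next
  case (Suc k)
  show ?case
  proof (rule Ck_on_Suc_intro[OF Suc.prems(1)])
    show "((\<lambda>x. inverse (f x)) has_derivative
        (\<lambda>v. - (inverse (f x) * frechet_derivative f (at x) v * inverse (f x)))) (at x)"
      if "x \<in> S" for x
      using Suc.prems that by (intro Deriv.has_derivative_inverse Ck_on_Suc_deriv) auto
    have "Ck_on k S (\<lambda>x. (-1) * (inverse (f x) * frechet_derivative f (at x) v * inverse (f x)))" for v
      using Suc Ck_on_SucD[of k S f]
      by (intro Ck_on_mult Suc.IH Ck_on_const) auto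
    then show "Ck_on k S (\<lambda>x. - (inverse (f x) * frechet_derivative f (at x) v * inverse (f x)))" for v
      by simp
  qed
qed

lemma Ck_on_compose:
  fixes f :: "'f::euclidean_space \<Rightarrow> real" and g :: "'e::euclidean_space \<Rightarrow> 'f"
  assumes "open S" "Ck_on k S g" "Ck_on k T f" "g ` S \<subseteq> T"
  shows "Ck_on k S (\<lambda>x. f (g x))"
  using assms
proof (induction k arbitrary: f)
  case 0
  then show ?case by (auto intro: continuous_on_compose2)
next
  case (Suc k)
  let ?Df = "\<lambda>y. frechet_derivative f (at y)" and ?Dg = "\<lambda>x. frechet_derivative g (at x)"
  show ?case
  proof (rule Ck_on_Suc_intro[OF Suc.prems(1)])
    fix x assume x: "x \<in> S"
    have f': "(f has_derivative ?Df (g x)) (at (g x))"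
      using Suc.prems x by (intro Ck_on_Suc_deriv) auto
    have g': "(g has_derivative ?Dg x) (at x)"
      using Suc.prems x by (intro Ck_on_Suc_deriv)
    have lin: "linear (?Df (g x))"
      using f' by (rule has_derivative_linear)
    \<comment> \<open>In the chain rule the direction \<open>?Dg x v\<close> moves with
      \<open>x\<close>, whereas \<open>Ck_on\<close> speaks of fixed directions. Expanding in the
      basis gives a sum of products of real functions, each with \<open>f\<close> differentiated in
      a fixed direction \<open>i\<close>, to which the induction hypothesis applies.\<close>
    have "?Df (g x) w = (\<Sum>i\<in>Basis. (w \<bullet> i) * ?Df (g x) i)" for w
    proof -
      have "?Df (g x) w = ?Df (g x) (\<Sum>i\<in>Basis. (w \<bullet> i) *\<^sub>R i)"
        by (simp add: euclidean_representation)
      also have "\<dots> = (\<Sum>i\<in>Basis. (w \<bullet> i) * ?Df (g x) i)"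
        using lin by (simp add: linear_sum linear_cmul)
      finally show ?thesis .
    qed
    then show "((\<lambda>x. f (g x)) has_derivative (\<lambda>v. \<Sum>i\<in>Basis. (?Dg x v \<bullet> i) * ?Df (g x) i)) (at x)"
      by (intro has_derivative_eq_rhs[OF has_derivative_compose[OF g' f']] ext)
  next
    fix v
    have "Ck_on k S (\<lambda>x. ?Dg x v \<bullet> i)" for i
      using Suc.prems by (intro Ck_on_bounded_linear[OF bounded_linear_inner_left]) auto
    then show "Ck_on k S (\<lambda>x. \<Sum>i\<in>Basis. (?Dg x v \<bullet> i) * ?Df (g x) i)"
      using Suc.prems by (intro Ck_on_sum Ck_on_mult Suc.IH Ck_on_SucD[of k S g]) auto
  qed
qed

section \<open>Bump functions on Euclidean spaces\<close>

text \<open>For \<open>n = 0\<close> this is the classical function that is smooth but flat at 0.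
  The powers of \<open>1/t\<close> are included so that the family is closed under differentiation
  up to linear combinations.\<close>

definition flat_exp :: "nat \<Rightarrow> real \<Rightarrow> real" where
  "flat_exp n t = (if t > 0 then exp (- (1 / t)) / t ^ n else 0)"

lemma flat_exp_tendsto_0: "(flat_exp n \<longlongrightarrow> 0) (at 0)"
proof -
  \<comment> \<open>With \<open>1/t\<close> as variable the claim becomes that the exponential
    outgrows every power.\<close>
  have "filterlim (\<lambda>t::real. 1 / t) at_top (at_right 0)"
    using filterlim_inverse_at_top_right by (simp add: inverse_eq_divide)
  then have "((\<lambda>t::real. (1 / t) ^ n / exp (1 / t)) \<longlongrightarrow> 0) (at_right 0)"
    by (rule filterlim_compose[OF tendsto_power_div_exp_0])
  then have R: "(flat_exp n \<longlongrightarrow> 0) (at_right 0)"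
  proof (rule Lim_transform_eventually)
    show "\<forall>\<^sub>F t in at_right 0. (1 / t) ^ n / exp (1 / t) = flat_exp n t"
      by (auto simp: flat_exp_def exp_minus field_simps eventually_at intro!: exI[of _ 1])
  qed
  have "\<forall>\<^sub>F t in at_left 0. 0 = flat_exp n t"
    by (auto simp: flat_exp_def eventually_at intro!: exI[of _ 1])
  then have "(flat_exp n \<longlongrightarrow> 0) (at_left 0)"
    by (rule Lim_transform_eventually[OF tendsto_const])
  with R show ?thesis
    by (simp add: filterlim_at_split)
qed

lemma has_derivative_flat_exp:
  "(flat_exp n has_real_derivative flat_exp (n + 2) t - n * flat_exp (n + 1) t) (at t)"
proof -
  consider "t > 0" | "t < 0" | "t = 0" by linarith
  then show ?thesis
  proof cases
    case 1
    have "n * t ^ (n - 1) * t = n * t ^ n"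
      by (cases n) auto
    then have "((\<lambda>t. exp (- (1 / t)) / t ^ n) has_real_derivative
        flat_exp (n + 2) t - n * flat_exp (n + 1) t) (at t)"
      using 1
      by (auto intro!: derivative_eq_intros simp: flat_exp_def field_simps power2_eq_square)
    then show ?thesis
      by (rule has_field_derivative_transform_within_open[where S="{0<..}"])
        (use 1 in \<open>auto simp: flat_exp_def\<close>)
  next
    case 2
    have "((\<lambda>t. 0) has_real_derivative flat_exp (n + 2) t - n * flat_exp (n + 1) t) (at t)"
      using 2 by (simp add: flat_exp_def)
    then show ?thesis
      by (rule has_field_derivative_transform_within_open[where S="{..<0}"])
        (use 2 in \<open>auto simp: flat_exp_def\<close>)
  next
    case 3
    \<comment> \<open>The difference quotient at 0 is again a member of the family, so its limit is
      already known; the claimed derivative at 0 is 0 as well.\<close>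
    have "flat_exp n h / h = flat_exp (Suc n) h" for h
      by (simp add: flat_exp_def)
    then show ?thesis
      using flat_exp_tendsto_0[of "Suc n"] 3
      by (simp add: has_field_derivative_iff flat_exp_def[of _ 0])
  qed
qed

lemma Ck_on_flat_exp: "Ck_on k UNIV (flat_exp n)"
proof (induction k arbitrary: n)
  case 0
  then show ?case
    by (auto intro!: continuous_at_imp_continuous_on DERIV_isCont[OF has_derivative_flat_exp])
next
  case (Suc k)
  show ?case
  proof (rule Ck_on_Suc_intro)
    show "(flat_exp n has_derivative
        (\<lambda>v. (flat_exp (n + 2) t + (- real n) * flat_exp (n + 1) t) * v)) (at t)" for t
      using has_derivative_flat_exp[of n t] by (simp add: has_field_derivative_def)
    show "Ck_on k UNIV (\<lambda>t. (flat_exp (n + 2) t + (- real n) * flat_exp (n + 1) t) * v)" for v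
      by (intro Ck_on_mult Ck_on_add Ck_on_const Suc.IH) auto
  qed auto
qed

text \<open>The bump is \<open>a / (a + c)\<close>, where \<open>a\<close> is positive exactly
  inside the ball of radius \<open>R\<close> and \<open>c\<close> exactly outside the closed ball of
  radius \<open>r\<close>. As \<open>r < R\<close>, they never vanish together. Squared distance is
  used because it is smooth at the centre too.\<close>

lemma ex_euclidean_bump:
  fixes y0 :: "'e::euclidean_space"
  assumes "0 < r" "r < R"
  obtains h :: "'e \<Rightarrow> real" where "Cinf_on UNIV h"
    "\<And>y. y \<in> ball y0 r \<Longrightarrow> h y = 1" "\<And>y. y \<notin> cball y0 R \<Longrightarrow> h y = 0"
proof
  define d where "d y = (y - y0) \<bullet> (y - y0)" for y
  define a where "a y = flat_exp 0 (R\<^sup>2 - d y)" for y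
  define c where "c y = flat_exp 0 (d y - r\<^sup>2)" for y
  have rR: "r\<^sup>2 < R\<^sup>2"
    using assms by (intro power_strict_mono) auto
  have d_dist: "d y = (dist y0 y)\<^sup>2" for y
    by (simp add: d_def dist_norm norm_minus_commute[of y0] flip: power2_norm_eq_inner)
  have inner: "Ck_on k UNIV (\<lambda>y::'e. (y - y0) \<bullet> i)" for k i
    using Ck_on_add[OF _ Ck_on_ident Ck_on_const, of UNIV k "- y0"]
    by (intro Ck_on_bounded_linear[OF bounded_linear_inner_left]) auto
  have "d = (\<lambda>y. \<Sum>i\<in>Basis. ((y - y0) \<bullet> i) * ((y - y0) \<bullet> i))"
    unfolding d_def by (intro ext euclidean_inner)
  then have d: "Ck_on k UNIV d" for k
    by (simp only:) (intro Ck_on_sum Ck_on_mult inner; simp)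
  have a: "Ck_on k UNIV a" for k
  proof -
    have "Ck_on k UNIV (\<lambda>y. R\<^sup>2 + (-1) * d y)"
      by (intro Ck_on_mult Ck_on_add Ck_on_const d) auto
    then show ?thesis
      unfolding a_def by (intro Ck_on_compose[OF _ _ Ck_on_flat_exp]) auto
  qed
  have c: "Ck_on k UNIV c" for k
  proof -
    have "Ck_on k UNIV (\<lambda>y. d y + - r\<^sup>2)"
      by (intro Ck_on_add Ck_on_const d) auto
    then show ?thesis
      unfolding c_def by (intro Ck_on_compose[OF _ _ Ck_on_flat_exp]) auto
  qed
  have pos: "a y + c y > 0" for y
    using rR by (auto simp: a_def c_def flat_exp_def add_pos_pos)
  have "Ck_on k UNIV (\<lambda>y. a y * inverse (a y + c y))" for k
    using pos by (intro Ck_on_mult Ck_on_inverse Ck_on_add a c) (simp_all add: less_imp_neq[THEN not_sym])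
  then show "Cinf_on UNIV (\<lambda>y. a y * inverse (a y + c y))"
    by (simp add: Cinf_on_def)
  show "a y * inverse (a y + c y) = 1" if "y \<in> ball y0 r" for y
  proof -
    have "d y < r\<^sup>2"
      using that assms unfolding d_dist by (intro power_strict_mono) auto
    then have "c y = 0" by (simp add: c_def flat_exp_def)
    then show ?thesis using pos[of y] by simp
  qed
  show "a y * inverse (a y + c y) = 0" if "y \<notin> cball y0 R" for y
  proof -
    have "R\<^sup>2 < d y"
      using that assms unfolding d_dist by (intro power_strict_mono) auto
    then show ?thesis by (simp add: a_def flat_exp_def)
  qed
qed

section \<open>Smooth functions on manifolds\<close>

locale smooth_atlas =
  fixes A :: "('a::{t2_space, second_countable_topology}, 'e::euclidean_space) chart set"
  assumes smooth_manifold: "smooth_manifold A"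
begin

lemma chart_homeomorphism:
  assumes "(V, \<phi>) \<in> A"
  shows "open V" "open (\<phi> ` V)" "homeomorphism V (\<phi> ` V) \<phi> (inv_into V \<phi>)"
  using smooth_manifold assms by (auto simp: smooth_manifold_def is_chart_def)

lemma chart_inv:
  assumes "(V, \<phi>) \<in> A" "x \<in> V"
  shows "inv_into V \<phi> (\<phi> x) = x"
  using chart_homeomorphism(3)[OF assms(1)] assms(2) by (auto simp: homeomorphism_def)

lemma chart_open_image:
  assumes "(V, \<phi>) \<in> A" "open U"
  shows "open (\<phi> ` (U \<inter> V))"
proof -
  have "openin (top_of_set V) (U \<inter> V)"
    using assms(2) by (metis Int_commute openin_open_Int)
  then have "openin (top_of_set (\<phi> ` V)) (\<phi> ` (U \<inter> V))"
    by (rule homeomorphism_imp_open_map[OF chart_homeomorphism(3)[OF assms(1)]])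
  then show ?thesis
    using openin_open_trans chart_homeomorphism(2)[OF assms(1)] by blast
qed

lemma ex_chart: obtains V \<phi> where "(V, \<phi>) \<in> A" "x \<in> V"
proof -
  have "x \<in> (\<Union>c\<in>A. fst c)"
    using smooth_manifold by (simp add: smooth_manifold_def)
  then show ?thesis using that by auto
qed

lemma smooth_funs_iff:
  "f \<in> smooth_funs A U \<longleftrightarrow>
    (\<forall>V \<phi> k. (V, \<phi>) \<in> A \<longrightarrow> Ck_on k (\<phi> ` (U \<inter> V)) (\<lambda>y. f (inv_into V \<phi> y)))"
  by (auto simp: smooth_funs_def Cinf_on_def o_def)

lemmas smooth_funsD = smooth_funs_iff[THEN iffD1, rule_format]

lemma smooth_funs_subset:
  assumes "f \<in> smooth_funs A U" "W \<subseteq> U"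
  shows "f \<in> smooth_funs A W"
  unfolding smooth_funs_iff
proof (intro allI impI)
  fix V \<phi> k assume "(V, \<phi>) \<in> A"
  then show "Ck_on k (\<phi> ` (W \<inter> V)) (\<lambda>y. f (inv_into V \<phi> y))"
    using assms(2) by (intro Ck_on_subset[OF smooth_funsD[OF assms(1)]]) auto
qed

lemma smooth_funs_cong:
  assumes "open U" "\<And>x. x \<in> U \<Longrightarrow> f x = g x" "f \<in> smooth_funs A U"
  shows "g \<in> smooth_funs A U"
  unfolding smooth_funs_iff
proof (intro allI impI)
  fix V \<phi> k assume V: "(V, \<phi>) \<in> A"
  have "f (inv_into V \<phi> y) = g (inv_into V \<phi> y)" if "y \<in> \<phi> ` (U \<inter> V)" for y
    using that chart_inv[OF V] assms(2) by auto
  then show "Ck_on k (\<phi> ` (U \<inter> V)) (\<lambda>y. g (inv_into V \<phi> y))"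
    by (rule Ck_on_transform[OF chart_open_image[OF V assms(1)] smooth_funsD[OF assms(3) V]])
qed

text \<open>Membership in \<open>smooth_funs\<close> is local. This justifies cut-offs extended by
  zero, and brackets that agree with a global bracket only near each point.\<close>

lemma smooth_funs_locally:
  assumes "\<And>x. x \<in> U \<Longrightarrow> \<exists>W. open W \<and> x \<in> W \<and> f \<in> smooth_funs A W"
  shows "f \<in> smooth_funs A U"
  unfolding smooth_funs_iff
proof (intro allI impI, rule Ck_on_locally)
  fix V \<phi> k y assume V: "(V, \<phi>) \<in> A" and "y \<in> \<phi> ` (U \<inter> V)"
  then obtain x where x: "x \<in> U" "x \<in> V" "y = \<phi> x" by auto
  then obtain W where "open W" "x \<in> W" "f \<in> smooth_funs A W" using assms by blast
  then show "\<exists>T. open T \<and> y \<in> T \<and> Ck_on k T (\<lambda>y. f (inv_into V \<phi> y))"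
    using x chart_open_image[OF V] smooth_funsD[OF _ V] by (intro exI[of _ "\<phi> ` (W \<inter> V)"]) auto
qed

section \<open>The algebra of smooth functions on an open set\<close>

lemma smooth_funs_const: "open U \<Longrightarrow> (\<lambda>x. c) \<in> smooth_funs A U"
  by (auto simp: smooth_funs_iff intro!: Ck_on_const chart_open_image)

lemma smooth_funs_add:
  "open U \<Longrightarrow> f \<in> smooth_funs A U \<Longrightarrow> g \<in> smooth_funs A U \<Longrightarrow> (\<lambda>x. f x + g x) \<in> smooth_funs A U"
  unfolding smooth_funs_iff by (auto intro!: Ck_on_add chart_open_image)

lemma smooth_funs_mult:
  "open U \<Longrightarrow> f \<in> smooth_funs A U \<Longrightarrow> g \<in> smooth_funs A U \<Longrightarrow> (\<lambda>x. f x * g x) \<in> smooth_funs A U"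
  unfolding smooth_funs_iff by (auto intro!: Ck_on_mult chart_open_image)

lemma smooth_funs_uminus:
  "open U \<Longrightarrow> f \<in> smooth_funs A U \<Longrightarrow> (\<lambda>x. - f x) \<in> smooth_funs A U"
  using smooth_funs_mult[OF _ smooth_funs_const, of U f "-1"] by simp

lemma smooth_funs_diff:
  "open U \<Longrightarrow> f \<in> smooth_funs A U \<Longrightarrow> g \<in> smooth_funs A U \<Longrightarrow> (\<lambda>x. f x - g x) \<in> smooth_funs A U"
  using smooth_funs_add[OF _ _ smooth_funs_uminus, of U f g] by simp

lemma smooth_funs_sum:
  assumes "open U" "\<And>i. i \<in> I \<Longrightarrow> f i \<in> smooth_funs A U"
  shows "(\<lambda>x. \<Sum>i\<in>I. f i x) \<in> smooth_funs A U"
  using assms(2)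
  by (induction I rule: infinite_finite_induct) (auto intro: smooth_funs_const smooth_funs_add assms(1))

lemma smooth_funs_prod:
  assumes "open U" "\<And>i. i \<in> I \<Longrightarrow> f i \<in> smooth_funs A U"
  shows "(\<lambda>x. \<Prod>i\<in>I. f i x) \<in> smooth_funs A U"
  using assms(2)
  by (induction I rule: infinite_finite_induct) (auto intro: smooth_funs_const smooth_funs_mult assms(1))

lemma smooth_funs_divide:
  assumes "open U" "f \<in> smooth_funs A U" "g \<in> smooth_funs A U" "\<And>x. x \<in> U \<Longrightarrow> g x \<noteq> 0"
  shows "(\<lambda>x. f x / g x) \<in> smooth_funs A U"
proof -
  have "(\<lambda>x. inverse (g x)) \<in> smooth_funs A U"
    unfolding smooth_funs_iff
  proof (intro allI impI Ck_on_inverse)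
    fix V \<phi> k assume V: "(V, \<phi>) \<in> A"
    then show "open (\<phi> ` (U \<inter> V))" "Ck_on k (\<phi> ` (U \<inter> V)) (\<lambda>y. g (inv_into V \<phi> y))"
      using chart_open_image assms smooth_funsD by blast+
    show "g (inv_into V \<phi> y) \<noteq> 0" if "y \<in> \<phi> ` (U \<inter> V)" for y
      using that chart_inv[OF V] assms(4) by auto
  qed
  from smooth_funs_mult[OF assms(1,2) this] show ?thesis
    by (simp add: divide_inverse)
qed

lemmas smooth_funs_intros = smooth_funs_const smooth_funs_add smooth_funs_mult smooth_funs_uminus
  smooth_funs_diff smooth_funs_sum smooth_funs_prod smooth_funs_divide

lemma smooth_funs_continuous:
  assumes "open U" "f \<in> smooth_funs A U"
  shows "continuous_on U f"
proof (rule continuous_at_imp_continuous_on, rule ballI)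
  fix x assume "x \<in> U"
  obtain V \<phi> where V: "(V, \<phi>) \<in> A" "x \<in> V" by (rule ex_chart)
  have "continuous_on V \<phi>"
    using chart_homeomorphism[OF V(1)] by (auto simp: homeomorphism_def)
  then have "continuous_on (U \<inter> V) \<phi>"
    by (rule continuous_on_subset) auto
  moreover have "continuous_on (\<phi> ` (U \<inter> V)) (\<lambda>y. f (inv_into V \<phi> y))"
    using smooth_funsD[OF assms(2) V(1), of 0] by simp
  ultimately have "continuous_on (U \<inter> V) (\<lambda>x. f (inv_into V \<phi> (\<phi> x)))"
    by (intro continuous_on_compose2[where f=\<phi> and g="\<lambda>y. f (inv_into V \<phi> y)"]) auto
  then have "continuous_on (U \<inter> V) f"
    by (rule continuous_on_eq) (simp add: chart_inv[OF V(1)])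
  then show "continuous (at x) f"
    using assms(1) chart_homeomorphism(1)[OF V(1)] V(2) \<open>x \<in> U\<close>
    by (simp add: continuous_on_eq_continuous_at open_Int)
qed

lemma smooth_funs_det:
  fixes M :: "'a \<Rightarrow> real^'n^'n"
  assumes "open U" "\<And>i j. (\<lambda>x. M x $ i $ j) \<in> smooth_funs A U"
  shows "(\<lambda>x. det (M x)) \<in> smooth_funs A U"
  unfolding det_def by (intro smooth_funs_intros assms)

end

section \<open>Smoothness of the inverse matrix\<close>

lemma matrix_inv_invertible:
  assumes "invertible M"
  shows "M ** matrix_inv M = mat 1" "matrix_inv M ** M = mat 1"
  using someI_ex[OF assms[unfolded invertible_def]] by (auto simp: matrix_inv_def)

text \<open>Cramer's rule for the equation \<open>M v = axis j 1\<close>, whose solution is column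
  \<open>j\<close> of the inverse. It exhibits each entry as a quotient of polynomials in the
  entries of \<open>M\<close>, hence as a smooth function.\<close>

lemma matrix_inv_component:
  fixes M :: "real^'n^'n"
  assumes "invertible M"
  shows "matrix_inv M $ m $ j = det (\<chi> i k. if k = m then axis j 1 $ i else M $ i $ k) / det M"
proof -
  have "M *v (matrix_inv M *v axis j 1) = axis j 1"
    using assms by (simp add: matrix_vector_mul_assoc matrix_inv_invertible)
  then have "matrix_inv M *v axis j 1 =
      (\<chi> k. det (\<chi> i l. if l = k then axis j 1 $ i else M $ i $ l) / det M)"
    using assms by (subst (asm) cramer) (auto simp: invertible_det_nz)
  then show ?thesis
    by (simp add: vec_eq_iff matrix_vector_mult_basis column_def)
qed

context smooth_atlas begin

lemma smooth_funs_matrix_inv: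
  fixes M :: "'a \<Rightarrow> real^'n^'n"
  assumes "open U" "\<And>i j. (\<lambda>x. M x $ i $ j) \<in> smooth_funs A U" "\<And>x. x \<in> U \<Longrightarrow> invertible (M x)"
  shows "(\<lambda>x. matrix_inv (M x) $ m $ j) \<in> smooth_funs A U"
proof -
  have "(\<lambda>x. if k = m then axis j 1 $ i else M x $ i $ k) \<in> smooth_funs A U" for i k
    using assms by (cases "k = m") (auto intro: smooth_funs_const)
  then have "(\<lambda>x. det (\<chi> i k. if k = m then axis j 1 $ i else M x $ i $ k) / det (M x))
      \<in> smooth_funs A U"
    using assms by (intro smooth_funs_divide smooth_funs_det) (auto simp: invertible_det_nz)
  then show ?thesis
    by (rule smooth_funs_cong[OF assms(1), rotated]) (simp add: matrix_inv_component assms(3))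
qed

text \<open>A Euclidean bump is pulled back along a chart and extended by zero. Its support lies in
  the compact set \<open>K\<close>, which is closed because the manifold is Hausdorff; smoothness is
  checked on the open cover by \<open>V\<close> and \<open>- K\<close>.\<close>

lemma ex_bump:
  assumes "open N" "x \<in> N"
  obtains b K where "b \<in> smooth_funs A UNIV" "closed K" "K \<subseteq> N" "\<And>y. y \<notin> K \<Longrightarrow> b y = 0"
    "\<forall>\<^sub>F y in nhds x. b y = 1"
proof -
  obtain V \<phi> where V: "(V, \<phi>) \<in> A" "x \<in> V" by (rule ex_chart)
  note hom = chart_homeomorphism[OF V(1)]
  have "open (\<phi> ` (N \<inter> V))" "\<phi> x \<in> \<phi> ` (N \<inter> V)"
    using chart_open_image[OF V(1) assms(1)] V assms by auto
  then obtain R where R: "R > 0" "cball (\<phi> x) R \<subseteq> \<phi> ` (N \<inter> V)"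
    using open_contains_cball by blast
  obtain h :: "'e \<Rightarrow> real" where h: "Cinf_on UNIV h"
    "\<And>y. y \<in> ball (\<phi> x) (R / 2) \<Longrightarrow> h y = 1" "\<And>y. y \<notin> cball (\<phi> x) R \<Longrightarrow> h y = 0"
    by (rule ex_euclidean_bump[of "R / 2" R "\<phi> x"]) (use R(1) in auto)
  define b where "b y = (if y \<in> V then h (\<phi> y) else 0)" for y
  define K where "K = inv_into V \<phi> ` cball (\<phi> x) R"
  have "continuous_on (\<phi> ` V) (inv_into V \<phi>)"
    using hom(3) by (auto simp: homeomorphism_def)
  then have "compact K"
    unfolding K_def using R(2) by (intro compact_continuous_image) (auto intro: continuous_on_subset)
  then have "closed K" by (rule compact_imp_closed)
  moreover have "K \<subseteq> N"
    unfolding K_def using R(2) chart_inv[OF V(1)] by auto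
  moreover have b0: "b y = 0" if "y \<notin> K" for y
  proof (cases "y \<in> V")
    case True
    then have "\<phi> y \<notin> cball (\<phi> x) R"
      using that chart_inv[OF V(1)] unfolding K_def by (metis imageI)
    then show ?thesis using h(3) by (simp add: b_def)
  qed (simp add: b_def)
  moreover have "b \<in> smooth_funs A UNIV"
  proof (rule smooth_funs_locally)
    fix y
    show "\<exists>W. open W \<and> y \<in> W \<and> b \<in> smooth_funs A W"
    proof (cases "y \<in> K")
      case True
      have "b \<in> smooth_funs A V"
        unfolding smooth_funs_iff
      proof (intro allI impI)
        fix W \<psi> k assume W: "(W, \<psi>) \<in> A"
        have "smooth_transition (W, \<psi>) (V, \<phi>)"
          using smooth_manifold W V unfolding smooth_manifold_def by blast
        \<comment> \<open>Seen in another chart, the pulled back bump is \<open>h\<close> composed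
          with a transition map.\<close>
        then have t: "Ck_on k (\<psi> ` (V \<inter> W)) (\<lambda>y. \<phi> (inv_into W \<psi> y))"
          by (simp add: smooth_transition_def Cinf_on_def o_def Int_commute)
        have "Ck_on k (\<psi> ` (V \<inter> W)) (\<lambda>y. h (\<phi> (inv_into W \<psi> y)))"
          using h(1) by (intro Ck_on_compose[OF chart_open_image t, where T=UNIV] W hom(1))
            (auto simp: Cinf_on_def)
        moreover have "h (\<phi> (inv_into W \<psi> y)) = b (inv_into W \<psi> y)" if "y \<in> \<psi> ` (V \<inter> W)" for y
          using that chart_inv[OF W] by (auto simp: b_def)
        ultimately show "Ck_on k (\<psi> ` (V \<inter> W)) (\<lambda>y. b (inv_into W \<psi> y))"
          by (rule Ck_on_transform[OF chart_open_image[OF W hom(1)]])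
      qed
      moreover have "y \<in> V"
        using True R(2) chart_inv[OF V(1)] by (auto simp: K_def)
      ultimately show ?thesis using hom(1) by blast
    next
      case False
      have "b \<in> smooth_funs A (- K)"
        using \<open>closed K\<close> by (intro smooth_funs_cong[OF _ _ smooth_funs_const[of _ 0]]) (auto simp: b0)
      then show ?thesis using False \<open>closed K\<close> by (intro exI[of _ "- K"]) auto
    qed
  qed
  moreover have "\<forall>\<^sub>F y in nhds x. b y = 1"
  proof -
    have "continuous_on V \<phi>"
      using hom by (auto simp: homeomorphism_def)
    then have "open (\<phi> -` ball (\<phi> x) (R / 2) \<inter> V)"
      using hom(1) by (simp add: continuous_on_open_vimage)
    then show ?thesis
      unfolding eventually_nhds using V(2) R(1) h(2)
      by (intro exI[of _ "\<phi> -` ball (\<phi> x) (R / 2) \<inter> V"]) (auto simp: b_def)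
  qed
  ultimately show ?thesis using that by blast
qed

text \<open>Multiplication by a bump supported in \<open>U\<close> keeps the germ at
  \<open>x\<close> and allows extension by zero; \<open>F\<close> need not agree with
  \<open>f\<close> on all of \<open>U\<close>.\<close>

lemma ex_smooth_extension:
  assumes "open U" "x \<in> U" "f \<in> smooth_funs A U"
  obtains F where "F \<in> smooth_funs A UNIV" "\<forall>\<^sub>F y in nhds x. F y = f y"
proof -
  obtain b K where b: "b \<in> smooth_funs A UNIV" "closed K" "K \<subseteq> U" "\<And>y. y \<notin> K \<Longrightarrow> b y = 0"
    "\<forall>\<^sub>F y in nhds x. b y = 1"
    using ex_bump[OF assms(1,2)] by blast
  have "(\<lambda>y. b y * f y) \<in> smooth_funs A UNIV"
  proof (rule smooth_funs_locally)
    fix y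
    show "\<exists>W. open W \<and> y \<in> W \<and> (\<lambda>y. b y * f y) \<in> smooth_funs A W"
    proof (cases "y \<in> K")
      case True
      have "(\<lambda>y. b y * f y) \<in> smooth_funs A U"
        using assms b(1) smooth_funs_subset by (intro smooth_funs_mult) auto
      then show ?thesis using True b(3) assms(1) by blast
    next
      case False
      have "(\<lambda>y. b y * f y) \<in> smooth_funs A (- K)"
        using b(2) by (intro smooth_funs_cong[OF _ _ smooth_funs_const[of _ 0]]) (auto simp: b(4))
      then show ?thesis using False b(2) by (intro exI[of _ "- K"]) auto
    qed
  qed
  moreover have "\<forall>\<^sub>F y in nhds x. b y * f y = f y"
    using b(5) by eventually_elim simp
  ultimately show ?thesis by (rule that)
qed

end

section \<open>Locality of Poisson brackets\<close>

locale poisson_manifold = smooth_atlas A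
  for A :: "('a::{t2_space, second_countable_topology}, 'e::euclidean_space) chart set" +
  fixes br :: "('a \<Rightarrow> real) \<Rightarrow> ('a \<Rightarrow> real) \<Rightarrow> 'a \<Rightarrow> real"
  assumes poisson_bracket: "poisson_bracket A br"
begin

lemma
  assumes "f \<in> smooth_funs A UNIV" "g \<in> smooth_funs A UNIV"
  shows br_smooth: "br f g \<in> smooth_funs A UNIV"
    and br_antisym: "br f g x = - br g f x"
  using poisson_bracket assms unfolding poisson_bracket_def Let_def by blast+

lemma
  assumes "f \<in> smooth_funs A UNIV" "g \<in> smooth_funs A UNIV" "h \<in> smooth_funs A UNIV"
  shows br_linear: "br (\<lambda>y. a * f y + b * g y) h x = a * br f h x + b * br g h x"
    and br_mult: "br (\<lambda>y. f y * g y) h x = f x * br g h x + br f h x * g x"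
    and br_jacobi: "br f (br g h) x + br g (br h f) x + br h (br f g) x = 0"
  using poisson_bracket assms unfolding poisson_bracket_def Let_def by blast+

text \<open>The difference \<open>D\<close> vanishes near \<open>x\<close>, so \<open>b D\<close> is
  identically zero for a bump \<open>b\<close> supported there. The Leibniz rule gives
  \<open>0 = b(x) {D, G}(x) + {b, G}(x) D(x)\<close>, where \<open>b(x) = 1\<close> and
  \<open>D(x) = 0\<close>.\<close>

lemma br_local_left:
  assumes F: "F \<in> smooth_funs A UNIV" "F' \<in> smooth_funs A UNIV" and G: "G \<in> smooth_funs A UNIV"
    and eq: "\<forall>\<^sub>F y in nhds x. F y = F' y"
  shows "br F G x = br F' G x"
proof -
  obtain N where N: "open N" "x \<in> N" "\<And>y. y \<in> N \<Longrightarrow> F y = F' y"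
    using eq unfolding eventually_nhds by blast
  obtain b K where b: "b \<in> smooth_funs A UNIV" "K \<subseteq> N" "\<And>y. y \<notin> K \<Longrightarrow> b y = 0"
    "\<forall>\<^sub>F y in nhds x. b y = 1"
    using ex_bump[OF N(1,2)] by metis
  have bx: "b x = 1" using b(4) by (rule eventually_nhds_x_imp_x)
  define D where "D y = 1 * F y + (-1) * F' y" for y
  have D: "D \<in> smooth_funs A UNIV"
    unfolding D_def using F by (intro smooth_funs_intros) auto
  have brD: "br D G x = br F G x - br F' G x"
    unfolding D_def by (subst br_linear) (use F G in auto)
  \<comment> \<open>The zero function is written as a linear combination so that bilinearity shows
    its bracket to vanish.\<close>
  have "(\<lambda>y. b y * D y) = (\<lambda>y. 0 * F y + 0 * F y)"
  proof
    show "b y * D y = 0 * F y + 0 * F y" for y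
      using N(3) b(2,3) by (cases "y \<in> K") (auto simp: D_def)
  qed
  then have "br (\<lambda>y. b y * D y) G x = 0"
    using br_linear[OF F(1) F(1) G, of 0 0] by simp
  moreover have "br (\<lambda>y. b y * D y) G x = b x * br D G x + br b G x * D x"
    by (rule br_mult[OF b(1) D G])
  moreover have "D x = 0" using N by (simp add: D_def)
  ultimately show ?thesis using brD bx by simp
qed

lemma br_local:
  assumes "F \<in> smooth_funs A UNIV" "F' \<in> smooth_funs A UNIV"
    and "G \<in> smooth_funs A UNIV" "G' \<in> smooth_funs A UNIV"
    and "\<forall>\<^sub>F y in nhds x. F y = F' y" "\<forall>\<^sub>F y in nhds x. G y = G' y"
  shows "br F G x = br F' G' x"
proof -
  have "br F G x = br F' G x" using assms by (intro br_local_left)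
  also have "\<dots> = - br G F' x" using assms by (intro br_antisym)
  also have "br G F' x = br G' F' x" using assms by (intro br_local_left)
  also have "- \<dots> = br F' G' x" using assms by (intro br_antisym[symmetric])
  finally show ?thesis .
qed

abbreviation "lb \<equiv> local_bracket A br"

text \<open>The definite description is meaningful: the given \<open>F\<close> and \<open>G\<close>
  provide a value, and locality of the bracket makes it the only one.\<close>

lemma lb_eq:
  assumes "F \<in> smooth_funs A UNIV" "G \<in> smooth_funs A UNIV"
    and "\<forall>\<^sub>F y in nhds x. F y = f y" "\<forall>\<^sub>F y in nhds x. G y = g y"
  shows "lb f g x = br F G x"
  unfolding local_bracket_def
proof (rule the_equality)
  show "\<exists>F'\<in>smooth_funs A UNIV. \<exists>G'\<in>smooth_funs A UNIV.
      (\<forall>\<^sub>F y in nhds x. F' y = f y \<and> G' y = g y) \<and> br F G x = br F' G' x"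
    using assms eventually_conj[OF assms(3,4)] by blast
next
  fix c
  assume "\<exists>F'\<in>smooth_funs A UNIV. \<exists>G'\<in>smooth_funs A UNIV.
      (\<forall>\<^sub>F y in nhds x. F' y = f y \<and> G' y = g y) \<and> c = br F' G' x"
  then obtain F' G' where *: "F' \<in> smooth_funs A UNIV" "G' \<in> smooth_funs A UNIV"
    "\<forall>\<^sub>F y in nhds x. F' y = f y \<and> G' y = g y" "c = br F' G' x" by blast
  have "\<forall>\<^sub>F y in nhds x. F' y = F y" "\<forall>\<^sub>F y in nhds x. G' y = G y"
    using *(3) assms(3,4) by (eventually_elim, simp)+
  then show "c = br F G x"
    using * assms br_local by blast
qed

lemma lb_global: "f \<in> smooth_funs A UNIV \<Longrightarrow> g \<in> smooth_funs A UNIV \<Longrightarrow> lb f g x = br f g x"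
  by (rule lb_eq) auto

text \<open>Agreement of germs at \<open>x\<close> persists at nearby points, so a single pair of
  global functions computes the local bracket on a whole neighbourhood. This is what makes the local
  bracket smooth.\<close>

lemma lb_eq_open:
  assumes "F \<in> smooth_funs A UNIV" "G \<in> smooth_funs A UNIV"
    and "\<forall>\<^sub>F y in nhds x. F y = f y" "\<forall>\<^sub>F y in nhds x. G y = g y"
  shows "\<forall>\<^sub>F y in nhds x. lb f g y = br F G y"
proof -
  have "\<forall>\<^sub>F y in nhds x. \<forall>\<^sub>F z in nhds y. F z = f z" "\<forall>\<^sub>F y in nhds x. \<forall>\<^sub>F z in nhds y. G z = g z"
    using assms(3,4) by (simp_all only: eventually_eventually)
  then show ?thesis
    by eventually_elim (rule lb_eq[OF assms(1,2)])
qed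

end

section \<open>Bracket calculus for functions smooth on an open set \<open>U\<close>\<close>

locale poisson_open = poisson_manifold A br
  for A :: "('a::{t2_space, second_countable_topology}, 'e::euclidean_space) chart set"
    and br +
  fixes U :: "'a set"
  assumes open_U: "open U"
begin

abbreviation "S \<equiv> smooth_funs A U"

lemmas S_intros = smooth_funs_intros[OF open_U]

lemma global_smooth: "f \<in> smooth_funs A UNIV \<Longrightarrow> f \<in> S"
  by (rule smooth_funs_subset) auto

lemma lb_smooth:
  assumes "f \<in> S" "g \<in> S"
  shows "lb f g \<in> S"
proof (rule smooth_funs_locally)
  fix x assume x: "x \<in> U"
  obtain F where F: "F \<in> smooth_funs A UNIV" "\<forall>\<^sub>F y in nhds x. F y = f y"
    by (rule ex_smooth_extension[OF open_U x assms(1)])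
  obtain G where G: "G \<in> smooth_funs A UNIV" "\<forall>\<^sub>F y in nhds x. G y = g y"
    by (rule ex_smooth_extension[OF open_U x assms(2)])
  obtain W where W: "open W" "x \<in> W" "\<And>y. y \<in> W \<Longrightarrow> lb f g y = br F G y"
    using lb_eq_open[OF F(1) G(1) F(2) G(2)] unfolding eventually_nhds by blast
  have "br F G \<in> smooth_funs A W"
    using br_smooth[OF F(1) G(1)] by (rule smooth_funs_subset) auto
  then have "lb f g \<in> smooth_funs A W"
    by (rule smooth_funs_cong[OF W(1), rotated]) (simp add: W(3))
  then show "\<exists>W. open W \<and> x \<in> W \<and> lb f g \<in> smooth_funs A W" using W by blast
qed

lemma lb_cong:
  assumes "x \<in> U" "\<And>y. y \<in> U \<Longrightarrow> f y = f' y" "\<And>y. y \<in> U \<Longrightarrow> g y = g' y"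
  shows "lb f g x = lb f' g' x"
proof -
  have U: "\<forall>\<^sub>F y in nhds x. y \<in> U"
    using open_U assms(1) by (rule eventually_nhds_in_open)
  have "(\<forall>\<^sub>F y in nhds x. F y = f y \<and> G y = g y) \<longleftrightarrow> (\<forall>\<^sub>F y in nhds x. F y = f' y \<and> G y = g' y)"
    for F G
    by (rule eventually_cong[OF U]) (simp add: assms)
  then show ?thesis
    by (simp add: local_bracket_def)
qed

lemma lb_antisym:
  assumes "x \<in> U" "f \<in> S" "g \<in> S"
  shows "lb f g x = - lb g f x"
proof -
  obtain F where F: "F \<in> smooth_funs A UNIV" "\<forall>\<^sub>F y in nhds x. F y = f y"
    by (rule ex_smooth_extension[OF open_U assms(1,2)])
  obtain G where G: "G \<in> smooth_funs A UNIV" "\<forall>\<^sub>F y in nhds x. G y = g y"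
    by (rule ex_smooth_extension[OF open_U assms(1,3)])
  show ?thesis
    using lb_eq[OF F(1) G(1) F(2) G(2)] lb_eq[OF G(1) F(1) G(2) F(2)] br_antisym[OF F(1) G(1)]
    by simp
qed

lemma
  assumes "x \<in> U" "f \<in> S" "g \<in> S" "h \<in> S"
  shows lb_linear_left: "lb (\<lambda>y. a * f y + b * g y) h x = a * lb f h x + b * lb g h x"
    and lb_mult_left: "lb (\<lambda>y. f y * g y) h x = f x * lb g h x + lb f h x * g x"
proof -
  obtain F where F: "F \<in> smooth_funs A UNIV" "\<forall>\<^sub>F y in nhds x. F y = f y"
    by (rule ex_smooth_extension[OF open_U assms(1,2)])
  obtain G where G: "G \<in> smooth_funs A UNIV" "\<forall>\<^sub>F y in nhds x. G y = g y"
    by (rule ex_smooth_extension[OF open_U assms(1,3)])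
  obtain H where H: "H \<in> smooth_funs A UNIV" "\<forall>\<^sub>F y in nhds x. H y = h y"
    by (rule ex_smooth_extension[OF open_U assms(1,4)])
  have eqs: "lb f h x = br F H x" "lb g h x = br G H x"
    using lb_eq F G H by auto
  have "lb (\<lambda>y. a * f y + b * g y) h x = br (\<lambda>y. a * F y + b * G y) H x"
  proof (rule lb_eq[OF _ H(1) _ H(2)])
    show "(\<lambda>y. a * F y + b * G y) \<in> smooth_funs A UNIV"
      using F G by (intro smooth_funs_intros) auto
    show "\<forall>\<^sub>F y in nhds x. a * F y + b * G y = a * f y + b * g y"
      using F(2) G(2) by eventually_elim simp
  qed
  then show "lb (\<lambda>y. a * f y + b * g y) h x = a * lb f h x + b * lb g h x"
    using br_linear[OF F(1) G(1) H(1)] eqs by simp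
  have "lb (\<lambda>y. f y * g y) h x = br (\<lambda>y. F y * G y) H x"
  proof (rule lb_eq[OF _ H(1) _ H(2)])
    show "(\<lambda>y. F y * G y) \<in> smooth_funs A UNIV"
      using F G by (intro smooth_funs_intros) auto
    show "\<forall>\<^sub>F y in nhds x. F y * G y = f y * g y"
      using F(2) G(2) by eventually_elim simp
  qed
  then show "lb (\<lambda>y. f y * g y) h x = f x * lb g h x + lb f h x * g x"
    using br_mult[OF F(1) G(1) H(1)] eqs eventually_nhds_x_imp_x[OF F(2)]
      eventually_nhds_x_imp_x[OF G(2)] by simp
qed

lemma lb_const_left:
  assumes "x \<in> U" "h \<in> S"
  shows "lb (\<lambda>y. c) h x = 0"
proof -
  \<comment> \<open>The Leibniz rule for \<open>1 = 1 * 1\<close> gives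
    \<open>{1, h} = 2 {1, h}\<close>.\<close>
  have "lb (\<lambda>y. 1) h x = 0"
    using lb_mult_left[of x "\<lambda>y. 1" "\<lambda>y. 1" h] assms by (simp add: S_intros)
  then show ?thesis
    using lb_linear_left[of x "\<lambda>y. 1" "\<lambda>y. 1" h c 0] assms by (simp add: S_intros)
qed

lemma lb_add_left:
  assumes "x \<in> U" "f \<in> S" "g \<in> S" "h \<in> S"
  shows "lb (\<lambda>y. f y + g y) h x = lb f h x + lb g h x"
  using lb_linear_left[OF assms, of 1 1] by simp

lemma lb_sum_left:
  assumes "x \<in> U" "\<And>i. i \<in> I \<Longrightarrow> f i \<in> S" "h \<in> S"
  shows "lb (\<lambda>y. \<Sum>i\<in>I. f i y) h x = (\<Sum>i\<in>I. lb (f i) h x)"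
  using assms(2)
proof (induction I rule: infinite_finite_induct)
  case (insert i I)
  then show ?case
    using lb_add_left[OF assms(1), of "f i" "\<lambda>y. \<Sum>i\<in>I. f i y" h] assms(3)
    by (simp add: S_intros)
qed (use lb_const_left assms in auto)

lemma lb_mult_right:
  assumes "x \<in> U" "f \<in> S" "g \<in> S" "h \<in> S"
  shows "lb h (\<lambda>y. f y * g y) x = f x * lb h g x + lb h f x * g x"
proof -
  have "lb h (\<lambda>y. f y * g y) x = - lb (\<lambda>y. f y * g y) h x"
    using assms by (intro lb_antisym S_intros)
  also have "lb (\<lambda>y. f y * g y) h x = f x * lb g h x + lb f h x * g x"
    by (rule lb_mult_left[OF assms])
  also have "lb g h x = - lb h g x" using assms by (intro lb_antisym)
  also have "lb f h x = - lb h f x" using assms by (intro lb_antisym)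
  finally show ?thesis by simp
qed

lemma lb_sum_right:
  assumes "x \<in> U" "\<And>i. i \<in> I \<Longrightarrow> f i \<in> S" "h \<in> S"
  shows "lb h (\<lambda>y. \<Sum>i\<in>I. f i y) x = (\<Sum>i\<in>I. lb h (f i) x)"
proof -
  have "lb h (\<lambda>y. \<Sum>i\<in>I. f i y) x = - (\<Sum>i\<in>I. lb (f i) h x)"
    using lb_sum_left[OF assms] lb_antisym[of x h "\<lambda>y. \<Sum>i\<in>I. f i y"] assms by (simp add: S_intros)
  also have "\<dots> = (\<Sum>i\<in>I. lb h (f i) x)"
    unfolding sum_negf[symmetric] using lb_antisym[of x h] assms by (intro sum.cong) auto
  finally show ?thesis .
qed

lemma lb_const_right:
  assumes "x \<in> U" "h \<in> S"
  shows "lb h (\<lambda>y. c) x = 0"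
  using lb_const_left[OF assms, of c] lb_antisym[of x h "\<lambda>y. c"] assms by (simp add: S_intros)

end

section \<open>Weakly abelian constraints\<close>

text \<open>Values at one point of the brackets of \<open>C\<^sub>i\<close>, \<open>T\<^sub>k\<close> and the entries of \<open>N = \<alpha>\<^sup>-\<^sup>1\<close>, where
  \<open>\<beta>\<close> and \<open>\<gamma>\<close> are rows of \<open>N\<close>: \<open>\<alpha> k d = {C\<^sub>k, T\<^sub>d}\<close>, \<open>P a b = {C\<^sub>a, C\<^sub>b}\<close>,
  \<open>X a b = {C\<^sub>a, \<gamma>\<^sub>b}\<close>, \<open>Y b a = {C\<^sub>b, \<beta>\<^sub>a}\<close>, \<open>Z a b = {\<beta>\<^sub>a, \<gamma>\<^sub>b}\<close>,
  \<open>Q a e d = {C\<^sub>a, {C\<^sub>e, T\<^sub>d}}\<close> and \<open>G a b k d = {f\<^sub>a\<^sub>b\<^sub>k, T\<^sub>d}\<close>. By the Jacobi identity \<open>J\<close>, the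
  terms linear in \<open>c\<close> cancel.\<close>

lemma weakly_abelian_algebra:
  fixes c t \<beta> \<gamma> :: "'n::finite \<Rightarrow> real"
  assumes X: "\<And>a b. X a b = - (\<Sum>d\<in>UNIV. \<Sum>e\<in>UNIV. \<gamma> e * Q a e d * N d b)"
    and Y: "\<And>a b. Y b a = - (\<Sum>d\<in>UNIV. \<Sum>e\<in>UNIV. \<beta> e * Q b e d * N d a)"
    and t: "\<And>d. t d = (\<Sum>b\<in>UNIV. N d b * c b)"
    and c: "\<And>k. c k = (\<Sum>d\<in>UNIV. \<alpha> k d * t d)"
    and P: "\<And>a b. P a b = (\<Sum>k\<in>UNIV. F a b k * c k)"
    and J: "\<And>a b d. Q a b d - Q b a d = (\<Sum>k\<in>UNIV. F a b k * \<alpha> k d + G a b k d * c k)"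
  shows "(\<Sum>a\<in>UNIV. \<Sum>b\<in>UNIV.
      \<beta> a * (\<gamma> b * P a b + X a b * c b) + (\<gamma> b * (- Y b a) + Z a b * c b) * c a) =
    (\<Sum>k\<in>UNIV. \<Sum>l\<in>UNIV. (\<Sum>a\<in>UNIV. \<Sum>b\<in>UNIV.
      Z a b * \<alpha> a k * \<alpha> b l - \<beta> a * \<gamma> b * (\<Sum>e\<in>UNIV. G a b e l * \<alpha> e k)) * t k * t l)"
    (is "?L = ?R")
proof -
  \<comment> \<open>\<open>R a b\<close> is the double bracket
    \<open>{C\<^sub>a, {C\<^sub>b, T\<^sub>d}}\<close> contracted with the new constraints
    \<open>t d\<close>. \<open>W\<close> is the part of the Jacobi identity that is quadratic in the
    constraints after the same contraction.\<close>
  define R where "R a b = (\<Sum>d\<in>UNIV. Q a b d * t d)" for a b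
  define W where "W a b = (\<Sum>k\<in>UNIV. \<Sum>d\<in>UNIV. G a b k d * c k * t d)" for a b
  \<comment> \<open>In both mixed terms the last factor \<open>N\<close> meets \<open>c\<close> and
    turns it into \<open>t\<close>; \<open>\<eta>\<close> will be \<open>\<gamma>\<close> for
    \<open>X\<close> and \<open>\<beta>\<close> for \<open>Y\<close>.\<close>
  have contract: "(\<Sum>b\<in>UNIV. (\<Sum>d\<in>UNIV. \<Sum>e\<in>UNIV. \<eta> e * Q a e d * N d b) * c b) =
      (\<Sum>e\<in>UNIV. \<eta> e * R a e)" for \<eta> a
  proof -
    have "(\<Sum>b\<in>UNIV. (\<Sum>d\<in>UNIV. \<Sum>e\<in>UNIV. \<eta> e * Q a e d * N d b) * c b) =
        (\<Sum>b\<in>UNIV. \<Sum>d\<in>UNIV. \<Sum>e\<in>UNIV. \<eta> e * Q a e d * (N d b * c b))"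
      by (simp add: sum_distrib_right mult.assoc)
    also have "\<dots> = (\<Sum>d\<in>UNIV. \<Sum>b\<in>UNIV. \<Sum>e\<in>UNIV. \<eta> e * Q a e d * (N d b * c b))"
      by (rule sum.swap)
    also have "\<dots> = (\<Sum>d\<in>UNIV. \<Sum>e\<in>UNIV. \<Sum>b\<in>UNIV. \<eta> e * Q a e d * (N d b * c b))"
      by (intro sum.cong refl sum.swap)
    also have "\<dots> = (\<Sum>d\<in>UNIV. \<Sum>e\<in>UNIV. \<eta> e * Q a e d * t d)"
      by (simp add: t sum_distrib_left)
    also have "\<dots> = (\<Sum>e\<in>UNIV. \<Sum>d\<in>UNIV. \<eta> e * Q a e d * t d)"
      by (rule sum.swap)
    also have "\<dots> = (\<Sum>e\<in>UNIV. \<eta> e * R a e)"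
      by (simp add: R_def sum_distrib_left mult.assoc)
    finally show ?thesis .
  qed
  have Xc: "(\<Sum>b\<in>UNIV. X a b * c b) = - (\<Sum>e\<in>UNIV. \<gamma> e * R a e)" for a
    using contract[of \<gamma> a] by (simp add: X sum_negf)
  have Yc: "(\<Sum>a\<in>UNIV. Y b a * c a) = - (\<Sum>e\<in>UNIV. \<beta> e * R b e)" for b
    using contract[of \<beta> b] by (simp add: Y sum_negf)
  \<comment> \<open>Contracting the Jacobi relation with \<open>t\<close> turns
    \<open>\<alpha> t\<close> back into \<open>c\<close>, so its first part becomes
    \<open>F c = P\<close>.\<close>
  have RR: "R a b - R b a = P a b + W a b" for a b
  proof -
    have "R a b - R b a = (\<Sum>d\<in>UNIV. (Q a b d - Q b a d) * t d)"
      by (simp add: R_def sum_subtractf left_diff_distrib)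
    also have "\<dots> = (\<Sum>d\<in>UNIV. \<Sum>k\<in>UNIV. F a b k * (\<alpha> k d * t d) + G a b k d * c k * t d)"
      by (simp only: J sum_distrib_right distrib_right mult.assoc)
    also have "\<dots> = (\<Sum>k\<in>UNIV. \<Sum>d\<in>UNIV. F a b k * (\<alpha> k d * t d) + G a b k d * c k * t d)"
      by (rule sum.swap)
    also have "\<dots> = (\<Sum>k\<in>UNIV. F a b k * (\<Sum>d\<in>UNIV. \<alpha> k d * t d)) + W a b"
      by (simp add: sum.distrib sum_distrib_left W_def)
    also have "\<dots> = P a b + W a b"
      by (simp add: P flip: c)
    finally show ?thesis .
  qed
  have "?L = (\<Sum>a\<in>UNIV. \<Sum>b\<in>UNIV. \<beta> a * \<gamma> b * P a b) + (\<Sum>a\<in>UNIV. \<beta> a * (\<Sum>b\<in>UNIV. X a b * c b))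
      - (\<Sum>a\<in>UNIV. \<Sum>b\<in>UNIV. \<gamma> b * (Y b a * c a)) + (\<Sum>a\<in>UNIV. \<Sum>b\<in>UNIV. Z a b * c a * c b)"
    by (simp add: algebra_simps sum.distrib sum_subtractf sum_distrib_left)
  also have "(\<Sum>a\<in>UNIV. \<Sum>b\<in>UNIV. \<gamma> b * (Y b a * c a)) = (\<Sum>b\<in>UNIV. \<gamma> b * (\<Sum>a\<in>UNIV. Y b a * c a))"
    by (subst sum.swap) (simp add: sum_distrib_left)
  also have "\<dots> = - (\<Sum>a\<in>UNIV. \<Sum>b\<in>UNIV. \<beta> a * \<gamma> b * R b a)"
    unfolding Yc by (subst sum.swap) (simp add: sum_distrib_left sum_negf algebra_simps)
  also have "(\<Sum>a\<in>UNIV. \<beta> a * (\<Sum>b\<in>UNIV. X a b * c b)) = - (\<Sum>a\<in>UNIV. \<Sum>b\<in>UNIV. \<beta> a * \<gamma> b * R a b)"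
    unfolding Xc by (simp add: sum_distrib_left sum_negf algebra_simps)
  \<comment> \<open>All terms linear in \<open>c\<close> are now gathered as
    \<open>P a b - (R a b - R b a)\<close>, which \<open>RR\<close> reduces to
    \<open>- W a b\<close>.\<close>
  finally have "?L = (\<Sum>a\<in>UNIV. \<Sum>b\<in>UNIV.
      Z a b * c a * c b - \<beta> a * \<gamma> b * ((R a b - R b a) - P a b))"
    by (simp add: algebra_simps sum.distrib sum_subtractf)
  also have "\<dots> = (\<Sum>a\<in>UNIV. \<Sum>b\<in>UNIV. Z a b * c a * c b - \<beta> a * \<gamma> b * W a b)"
    by (simp only: RR) simp
  also have "\<dots> = (\<Sum>a\<in>UNIV. \<Sum>b\<in>UNIV. \<Sum>k\<in>UNIV. \<Sum>l\<in>UNIV.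
      (Z a b * \<alpha> a k * \<alpha> b l - \<beta> a * \<gamma> b * (\<Sum>e\<in>UNIV. G a b e l * \<alpha> e k)) * t k * t l)"
  proof (intro sum.cong refl)
    fix a b
    \<comment> \<open>What remains is quadratic in \<open>c\<close> or mixed in \<open>c\<close> and
      \<open>t\<close>; substituting \<open>c = \<alpha> t\<close> makes it quadratic in
      \<open>t\<close>, and the rest is reordering of sums.\<close>
    have cc: "c a * c b = (\<Sum>k\<in>UNIV. \<Sum>l\<in>UNIV. \<alpha> a k * \<alpha> b l * t k * t l)"
      unfolding c by (simp add: sum_product algebra_simps)
    have "W a b = (\<Sum>e\<in>UNIV. \<Sum>l\<in>UNIV. \<Sum>k\<in>UNIV. G a b e l * \<alpha> e k * t k * t l)"
      unfolding W_def c by (simp add: sum_distrib_left sum_distrib_right algebra_simps)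
    also have "\<dots> = (\<Sum>e\<in>UNIV. \<Sum>k\<in>UNIV. \<Sum>l\<in>UNIV. G a b e l * \<alpha> e k * t k * t l)"
      by (intro sum.cong refl sum.swap)
    also have "\<dots> = (\<Sum>k\<in>UNIV. \<Sum>e\<in>UNIV. \<Sum>l\<in>UNIV. G a b e l * \<alpha> e k * t k * t l)"
      by (rule sum.swap)
    also have "\<dots> = (\<Sum>k\<in>UNIV. \<Sum>l\<in>UNIV. \<Sum>e\<in>UNIV. G a b e l * \<alpha> e k * t k * t l)"
      by (intro sum.cong refl sum.swap)
    finally have W: "W a b = (\<Sum>k\<in>UNIV. \<Sum>l\<in>UNIV. (\<Sum>e\<in>UNIV. G a b e l * \<alpha> e k) * t k * t l)"
      by (simp add: sum_distrib_right)
    show "Z a b * c a * c b - \<beta> a * \<gamma> b * W a b = (\<Sum>k\<in>UNIV. \<Sum>l\<in>UNIV.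
        (Z a b * \<alpha> a k * \<alpha> b l - \<beta> a * \<gamma> b * (\<Sum>e\<in>UNIV. G a b e l * \<alpha> e k)) * t k * t l)"
      unfolding mult.assoc[of "Z a b"] cc W sum_distrib_left sum_subtractf[symmetric]
      by (intro sum.cong refl) (simp only: algebra_simps sum_distrib_left)
  qed
  also have "\<dots> = (\<Sum>a\<in>UNIV. \<Sum>k\<in>UNIV. \<Sum>b\<in>UNIV. \<Sum>l\<in>UNIV.
      (Z a b * \<alpha> a k * \<alpha> b l - \<beta> a * \<gamma> b * (\<Sum>e\<in>UNIV. G a b e l * \<alpha> e k)) * t k * t l)"
    by (intro sum.cong refl sum.swap)
  also have "\<dots> = (\<Sum>k\<in>UNIV. \<Sum>a\<in>UNIV. \<Sum>l\<in>UNIV. \<Sum>b\<in>UNIV.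
      (Z a b * \<alpha> a k * \<alpha> b l - \<beta> a * \<gamma> b * (\<Sum>e\<in>UNIV. G a b e l * \<alpha> e k)) * t k * t l)"
    by (subst sum.swap) (intro sum.cong refl sum.swap)
  also have "\<dots> = (\<Sum>k\<in>UNIV. \<Sum>l\<in>UNIV. \<Sum>a\<in>UNIV. \<Sum>b\<in>UNIV.
      (Z a b * \<alpha> a k * \<alpha> b l - \<beta> a * \<gamma> b * (\<Sum>e\<in>UNIV. G a b e l * \<alpha> e k)) * t k * t l)"
    by (intro sum.cong refl sum.swap)
  also have "\<dots> = ?R"
    by (simp only: sum_distrib_right)
  finally show ?thesis .
qed

section \<open>The clock matrix, its inverse, and the new constraints\<close>

locale clock_constraints = poisson_open A br U
  for A :: "('a::{t2_space, second_countable_topology}, 'e::euclidean_space) chart set"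
    and br U +
  fixes C T :: "'n::finite \<Rightarrow> 'a \<Rightarrow> real" and f :: "'n \<Rightarrow> 'n \<Rightarrow> 'n \<Rightarrow> 'a \<Rightarrow> real"
  assumes C: "C i \<in> smooth_funs A UNIV"
    and T: "T i \<in> smooth_funs A UNIV"
    and f: "f i j k \<in> smooth_funs A UNIV"
    and br_C: "br (C i) (C j) x = (\<Sum>k\<in>UNIV. f i j k x * C k x)"
    and clock_invertible: "x \<in> U \<Longrightarrow> invertible (clock_matrix br C T x)"
begin

definition \<alpha> :: "'n \<Rightarrow> 'n \<Rightarrow> 'a \<Rightarrow> real" where
  "\<alpha> j k = br (C j) (T k)"

definition N :: "'n \<Rightarrow> 'n \<Rightarrow> 'a \<Rightarrow> real" where
  "N m j x = matrix_inv (clock_matrix br C T x) $ m $ j"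

abbreviation "Ct \<equiv> new_constraint br C T"

lemma Ct_eq: "Ct m = (\<lambda>x. \<Sum>j\<in>UNIV. N m j x * C j x)"
  by (simp add: fun_eq_iff new_constraint_def N_def)

lemma \<alpha>_smooth: "\<alpha> j k \<in> smooth_funs A UNIV"
  unfolding \<alpha>_def by (intro br_smooth C T)

lemma N_smooth: "N m j \<in> S"
proof -
  have "(\<lambda>x. clock_matrix br C T x $ i $ k) \<in> S" for i k
    using global_smooth[OF \<alpha>_smooth] by (simp add: clock_matrix_def \<alpha>_def)
  then show ?thesis
    unfolding N_def by (intro smooth_funs_matrix_inv open_U clock_invertible)
qed

lemmas in_S = N_smooth C[THEN global_smooth] T[THEN global_smooth] f[THEN global_smooth]
  \<alpha>_smooth[THEN global_smooth]

lemma Ct_smooth: "Ct m \<in> S"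
  unfolding Ct_eq by (intro S_intros in_S)

lemma N_\<alpha>:
  assumes "x \<in> U"
  shows "(\<Sum>a\<in>UNIV. N m a x * \<alpha> a k x) = (if m = k then 1 else 0)"
  using arg_cong[OF matrix_inv_invertible(2)[OF clock_invertible[OF assms]], of "\<lambda>M. M $ m $ k"]
  by (simp add: matrix_matrix_mult_def mat_def N_def \<alpha>_def clock_matrix_def)

lemma \<alpha>_N:
  assumes "x \<in> U"
  shows "(\<Sum>k\<in>UNIV. \<alpha> a k x * N k b x) = (if a = b then 1 else 0)"
  using arg_cong[OF matrix_inv_invertible(1)[OF clock_invertible[OF assms]], of "\<lambda>M. M $ a $ b"]
  by (simp add: matrix_matrix_mult_def mat_def N_def \<alpha>_def clock_matrix_def)

text \<open>Inverting the definition of the new constraints shows that the old ones are linear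
  combinations of them, so terms quadratic in \<open>C\<close> are quadratic in
  \<open>Ct\<close>.\<close>

lemma C_eq:
  assumes "x \<in> U"
  shows "C a x = (\<Sum>l\<in>UNIV. \<alpha> a l x * Ct l x)"
proof -
  have "(\<Sum>l\<in>UNIV. \<alpha> a l x * Ct l x) = (\<Sum>b\<in>UNIV. \<Sum>l\<in>UNIV. \<alpha> a l x * N l b x * C b x)"
    by (subst sum.swap) (simp add: Ct_eq sum_distrib_left mult.assoc)
  also have "\<dots> = (\<Sum>b\<in>UNIV. (if a = b then 1 else 0) * C b x)"
    by (simp only: \<alpha>_N[OF assms] flip: sum_distrib_right)
  also have "\<dots> = C a x" by (simp add: if_distrib[of "\<lambda>u. u * _"] cong: if_cong)
  finally show ?thesis by simp
qed

text \<open>The derivation \<open>{h, _}\<close> applied to the constant matrix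
  \<open>N \<alpha> = 1\<close> gives \<open>{h, N} \<alpha> = - N {h, \<alpha>}\<close>;
  multiplication by \<open>N\<close> on the right, with \<open>\<alpha> N = 1\<close>, isolates
  \<open>{h, N}\<close>.\<close>

lemma lb_N:
  assumes x: "x \<in> U" and h: "h \<in> S"
  shows "lb h (N j b) x =
    - (\<Sum>d\<in>UNIV. \<Sum>e\<in>UNIV. N j e x * lb h (\<alpha> e d) x * N d b x)"
proof -
  have *: "(\<Sum>e\<in>UNIV. lb h (N j e) x * \<alpha> e d x) = - (\<Sum>e\<in>UNIV. N j e x * lb h (\<alpha> e d) x)" for d
  proof -
    have "0 = lb h (\<lambda>y. if j = d then 1 else 0) x"
      by (rule lb_const_right[OF x h, symmetric])
    also have "\<dots> = lb h (\<lambda>y. \<Sum>e\<in>UNIV. N j e y * \<alpha> e d y) x"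
      by (rule lb_cong[OF x]) (simp_all add: N_\<alpha>)
    also have "\<dots> = (\<Sum>e\<in>UNIV. lb h (\<lambda>y. N j e y * \<alpha> e d y) x)"
      by (intro lb_sum_right x h S_intros in_S)
    also have "\<dots> = (\<Sum>e\<in>UNIV. N j e x * lb h (\<alpha> e d) x + lb h (N j e) x * \<alpha> e d x)"
      by (intro sum.cong refl lb_mult_right x h in_S)
    finally show ?thesis by (simp add: sum.distrib)
  qed
  have "lb h (N j b) x = (\<Sum>e\<in>UNIV. lb h (N j e) x * (if e = b then 1 else 0))"
    by (simp add: if_distrib[of "\<lambda>u. _ * u"] cong: if_cong)
  also have "\<dots> = (\<Sum>e\<in>UNIV. \<Sum>d\<in>UNIV. lb h (N j e) x * \<alpha> e d x * N d b x)"
    by (simp only: sum_distrib_left mult.assoc flip: \<alpha>_N[OF x])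
  also have "\<dots> = (\<Sum>d\<in>UNIV. (\<Sum>e\<in>UNIV. lb h (N j e) x * \<alpha> e d x) * N d b x)"
    by (subst sum.swap) (simp add: sum_distrib_right)
  also have "\<dots> = - (\<Sum>d\<in>UNIV. \<Sum>e\<in>UNIV. N j e x * lb h (\<alpha> e d) x * N d b x)"
    unfolding * by (simp add: sum_negf sum_distrib_right)
  finally show ?thesis .
qed

lemma lb_combination_left:
  assumes "x \<in> U" "\<And>a. h a \<in> S" "g \<in> S"
  shows "lb (\<lambda>y. \<Sum>a\<in>UNIV. h a y * C a y) g x =
    (\<Sum>a\<in>UNIV. h a x * lb (C a) g x + lb (h a) g x * C a x)"
proof -
  have "lb (\<lambda>y. \<Sum>a\<in>UNIV. h a y * C a y) g x = (\<Sum>a\<in>UNIV. lb (\<lambda>y. h a y * C a y) g x)"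
    by (intro lb_sum_left assms S_intros in_S)
  also have "\<dots> = (\<Sum>a\<in>UNIV. h a x * lb (C a) g x + lb (h a) g x * C a x)"
    by (intro sum.cong refl lb_mult_left assms in_S)
  finally show ?thesis .
qed

lemma lb_combination_right:
  assumes "x \<in> U" "\<And>a. h a \<in> S" "g \<in> S"
  shows "lb g (\<lambda>y. \<Sum>a\<in>UNIV. h a y * C a y) x =
    (\<Sum>a\<in>UNIV. h a x * lb g (C a) x + lb g (h a) x * C a x)"
proof -
  have "lb g (\<lambda>y. \<Sum>a\<in>UNIV. h a y * C a y) x = (\<Sum>a\<in>UNIV. lb g (\<lambda>y. h a y * C a y) x)"
    by (intro lb_sum_right assms S_intros in_S)
  also have "\<dots> = (\<Sum>a\<in>UNIV. h a x * lb g (C a) x + lb g (h a) x * C a x)"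
    by (intro sum.cong refl lb_mult_right assms in_S)
  finally show ?thesis .
qed

lemma lb_C: "lb (C a) (C b) x = (\<Sum>k\<in>UNIV. f a b k x * C k x)"
  by (simp add: lb_global C br_C)

text \<open>The Jacobi identity for \<open>C a\<close>, \<open>C b\<close>, \<open>T d\<close>
  collapses the difference to \<open>{{C\<^sub>a, C\<^sub>b}, T\<^sub>d}\<close>. The first class
  relation and the Leibniz rule then expand it.\<close>

lemma jacobi_clock:
  assumes x: "x \<in> U"
  shows "lb (C a) (\<alpha> b d) x - lb (C b) (\<alpha> a d) x =
    (\<Sum>k\<in>UNIV. f a b k x * \<alpha> k d x + lb (f a b k) (T d) x * C k x)"
proof -
  \<comment> \<open>The summand with coefficient 0 fits the negation into the two-term linearity
    axiom.\<close>
  have "br (T d) (C a) = (\<lambda>y. (-1) * \<alpha> a d y + 0 * \<alpha> a d y)"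
    using br_antisym[OF T C] by (auto simp: \<alpha>_def fun_eq_iff)
  then have "br (br (T d) (C a)) (C b) x = - br (\<alpha> a d) (C b) x"
    by (simp only: br_linear \<alpha>_smooth C)
  then have "br (C b) (br (T d) (C a)) x = - br (C b) (\<alpha> a d) x"
    using br_antisym[of "C b" "br (T d) (C a)" x] br_antisym[of "C b" "\<alpha> a d" x]
    by (simp only: br_smooth C T \<alpha>_smooth)
  moreover have "br (T d) (br (C a) (C b)) x = - br (br (C a) (C b)) (T d) x"
    by (intro br_antisym br_smooth C T)
  ultimately have "br (C a) (\<alpha> b d) x - br (C b) (\<alpha> a d) x = br (br (C a) (C b)) (T d) x"
    using br_jacobi[OF C[of a] C[of b] T[of d], of x] by (simp add: \<alpha>_def)
  then have "lb (C a) (\<alpha> b d) x - lb (C b) (\<alpha> a d) x = lb (br (C a) (C b)) (T d) x"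
    by (simp only: lb_global br_smooth C T \<alpha>_smooth)
  also have "\<dots> = lb (\<lambda>y. \<Sum>k\<in>UNIV. f a b k y * C k y) (T d) x"
    by (rule lb_cong[OF x]) (simp_all add: br_C)
  also have "\<dots> = (\<Sum>k\<in>UNIV. f a b k x * \<alpha> k d x + lb (f a b k) (T d) x * C k x)"
    by (subst lb_combination_left) (simp_all add: x in_S lb_global C T \<alpha>_def)
  finally show ?thesis .
qed

text \<open>The coefficients produced by \<open>weakly_abelian_algebra\<close>: the first term comes
  from \<open>{N, N} C C\<close>, the second from brackets of the first class structure functions
  with the clocks.\<close>

definition structure_fun :: "'n \<Rightarrow> 'n \<Rightarrow> 'n \<Rightarrow> 'n \<Rightarrow> 'a \<Rightarrow> real" where
  "structure_fun m j k l x = (\<Sum>a\<in>UNIV. \<Sum>b\<in>UNIV.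
    lb (N m a) (N j b) x * \<alpha> a k x * \<alpha> b l x -
    N m a x * N j b x * (\<Sum>e\<in>UNIV. lb (f a b e) (T l) x * \<alpha> e k x))"

lemma structure_fun_smooth: "structure_fun m j k l \<in> S"
  unfolding structure_fun_def by (intro S_intros in_S lb_smooth)

lemma weakly_abelian:
  assumes x: "x \<in> U"
  shows "lb (Ct m) (Ct j) x =
    (\<Sum>k\<in>UNIV. \<Sum>l\<in>UNIV. structure_fun m j k l x * Ct k x * Ct l x)"
proof -
  have "lb (Ct m) (Ct j) x = (\<Sum>a\<in>UNIV. N m a x * lb (C a) (Ct j) x + lb (N m a) (Ct j) x * C a x)"
    unfolding Ct_eq[of m] by (intro lb_combination_left x Ct_smooth in_S)
  also have "\<dots> = (\<Sum>a\<in>UNIV.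
      N m a x * (\<Sum>b\<in>UNIV. N j b x * lb (C a) (C b) x + lb (C a) (N j b) x * C b x) +
      (\<Sum>b\<in>UNIV. N j b x * lb (N m a) (C b) x + lb (N m a) (N j b) x * C b x) * C a x)"
    unfolding Ct_eq[of j] by (simp only: lb_combination_right x in_S)
  \<comment> \<open>Antisymmetry puts \<open>C\<close> first in both kinds of mixed brackets, so
    that \<open>lb_N\<close> covers each of them.\<close>
  also have "\<dots> = (\<Sum>a\<in>UNIV. \<Sum>b\<in>UNIV.
      N m a x * (N j b x * lb (C a) (C b) x + lb (C a) (N j b) x * C b x) +
      (N j b x * (- lb (C b) (N m a) x) + lb (N m a) (N j b) x * C b x) * C a x)"
    by (simp only: sum_distrib_left sum_distrib_right sum.distrib[symmetric]
        lb_antisym[OF x N_smooth C[THEN global_smooth]])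
  also have "\<dots> = (\<Sum>k\<in>UNIV. \<Sum>l\<in>UNIV. structure_fun m j k l x * Ct k x * Ct l x)"
    unfolding structure_fun_def
  proof (rule weakly_abelian_algebra[where Q="\<lambda>a e d. lb (C a) (\<alpha> e d) x"
        and N="\<lambda>d b. N d b x" and F="\<lambda>a b k. f a b k x"])
    show "lb (C a) (N j b) x = - (\<Sum>d\<in>UNIV. \<Sum>e\<in>UNIV. N j e x * lb (C a) (\<alpha> e d) x * N d b x)" for j a b
      by (intro lb_N x in_S)
    then show "lb (C a) (N m b) x = - (\<Sum>d\<in>UNIV. \<Sum>e\<in>UNIV. N m e x * lb (C a) (\<alpha> e d) x * N d b x)" for a b .
    show "Ct d x = (\<Sum>b\<in>UNIV. N d b x * C b x)" for d
      by (simp add: Ct_eq)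
    show "C k x = (\<Sum>d\<in>UNIV. \<alpha> k d x * Ct d x)" for k
      by (rule C_eq[OF x])
    show "lb (C a) (C b) x = (\<Sum>k\<in>UNIV. f a b k x * C k x)" for a b
      by (rule lb_C)
    show "lb (C a) (\<alpha> b d) x - lb (C b) (\<alpha> a d) x =
        (\<Sum>k\<in>UNIV. f a b k x * \<alpha> k d x + lb (f a b k) (T d) x * C k x)" for a b d
      by (rule jacobi_clock[OF x])
  qed
  finally show ?thesis .
qed

end

section \<open>Linear evolution of the clocks\<close>

text \<open>A Gronwall argument: the sum of squares \<open>v\<close> satisfies
  \<open>v' \<le> L v\<close> with \<open>L\<close> taken from bounds on the coefficients, so
  \<open>v exp(-L s)\<close> cannot grow from its initial value 0.\<close>

lemma linear_ode_zero:
  fixes u :: "'n::finite \<Rightarrow> real \<Rightarrow> real"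
  assumes u': "\<And>m t. t \<in> {0..T} \<Longrightarrow>
      (u m has_real_derivative (\<Sum>k\<in>UNIV. g m k t * u k t)) (at t within {0..T})"
    and g: "\<And>m k. continuous_on {0..T} (g m k)"
    and u0: "\<And>m. u m 0 = 0" and t: "t \<in> {0..T}"
  shows "u m t = 0"
proof -
  have "\<exists>K. \<forall>s\<in>{0..T}. \<bar>g m k s\<bar> \<le> K" for m k
    using compact_imp_bounded[OF compact_continuous_image[OF g[of m k] compact_Icc]]
    by (auto simp: bounded_iff)
  then obtain K where K: "\<And>m k s. s \<in> {0..T} \<Longrightarrow> \<bar>g m k s\<bar> \<le> K m k" by metis
  define v where "v s = (\<Sum>m\<in>UNIV. (u m s)\<^sup>2)" for s
  define L where "L = 2 * (\<Sum>m\<in>UNIV. \<Sum>k\<in>UNIV. K m k)"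
  define v' where "v' s = (\<Sum>m\<in>UNIV. 2 * u m s * (\<Sum>k\<in>UNIV. g m k s * u k s))" for s
  have v': "(v has_real_derivative v' s) (at s within {0..T})" if "s \<in> {0..T}" for s
    unfolding v_def v'_def using that
    by (auto intro!: derivative_eq_intros u' sum.cong)
  have bound: "v' s \<le> L * v s" if s: "s \<in> {0..T}" for s
  proof -
    have "2 * u m s * (g m k s * u k s) \<le> 2 * K m k * v s" for m k
    proof -
      have sq: "(u i s)\<^sup>2 \<le> v s" for i
        unfolding v_def by (rule member_le_sum) auto
      \<comment> \<open>The inequality \<open>2 |x y| \<le> x^2 + y^2\<close>, with each square at
        most \<open>v s\<close>.\<close>
      have "\<bar>u m s * u k s\<bar> \<le> v s"
      proof -
        have "2 * \<bar>u m s * u k s\<bar> \<le> (u m s)\<^sup>2 + (u k s)\<^sup>2"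
          using sum_squares_bound[of "\<bar>u m s\<bar>" "\<bar>u k s\<bar>"] by (simp add: abs_mult)
        then show ?thesis using sq[of m] sq[of k] by simp
      qed
      then have "\<bar>g m k s\<bar> * \<bar>u m s * u k s\<bar> \<le> K m k * v s"
        using K[OF s, of m k] by (intro mult_mono) auto
      moreover have "g m k s * (u m s * u k s) \<le> \<bar>g m k s\<bar> * \<bar>u m s * u k s\<bar>"
        by (simp flip: abs_mult)
      ultimately show ?thesis by (simp add: algebra_simps)
    qed
    then have "v' s \<le> (\<Sum>m\<in>UNIV. \<Sum>k\<in>UNIV. 2 * K m k * v s)"
      unfolding v'_def sum_distrib_left by (intro sum_mono)
    also have "\<dots> = L * v s"
      by (simp add: L_def sum_distrib_left sum_distrib_right)
    finally show ?thesis .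
  qed
  define w where "w s = v s * exp (- (L * s))" for s
  have w': "(w has_real_derivative (v' s - L * v s) * exp (- (L * s))) (at s within {0..T})"
    if "s \<in> {0..T}" for s
    unfolding w_def using that
    by (auto intro!: derivative_eq_intros v' simp: algebra_simps)
  have "w t \<le> w 0"
  proof -
    have "\<exists>s\<in>{0..t}. w t - w 0 = (v' s - L * v s) * exp (- (L * s)) * (t - 0)"
    proof (rule mvt_very_simple)
      show "(w has_derivative (*) ((v' s - L * v s) * exp (- (L * s)))) (at s within {0..t})"
        if "0 \<le> s" "s \<le> t" for s
        using w'[of s] that t
        by (auto simp: has_field_derivative_def intro: has_derivative_subset)
    qed (use t in auto)
    then obtain s where s: "s \<in> {0..t}" "w t - w 0 = (v' s - L * v s) * (exp (- (L * s)) * t)"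
      by auto
    then have "w t - w 0 \<le> 0"
      using bound[of s] t by (auto intro!: mult_nonpos_nonneg)
    then show ?thesis by simp
  qed
  moreover have "w 0 = 0"
    by (simp add: w_def v_def u0)
  ultimately have "v t \<le> 0"
    by (simp add: w_def mult_le_0_iff)
  moreover have "(u m t)\<^sup>2 \<le> v t"
    unfolding v_def by (rule member_le_sum) auto
  ultimately show ?thesis
    by (metis order_trans power2_less_eq_zero_iff)
qed


context clock_constraints begin

lemma clock_evolution:
  fixes b :: "real^'n"
  assumes x: "x \<in> constraint_surface C"
    and flow: "ham_flow A br U (\<lambda>z. \<Sum>j\<in>UNIV. b $ j * Ct j z) 1 x y"
  shows "T k y = T k x + b $ k"
proof -
  let ?H = "\<lambda>z. \<Sum>j\<in>UNIV. b $ j * Ct j z"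
  \<comment> \<open>The generator is \<open>\<Sum> h\<^sub>a C\<^sub>a\<close>, a combination of the
    original constraints, to which the first class relations apply directly.\<close>
  define h where "h a = (\<lambda>z. \<Sum>j\<in>UNIV. b $ j * N j a z)" for a
  have h: "h a \<in> S" for a
    unfolding h_def by (intro S_intros in_S)
  have H_eq: "?H = (\<lambda>z. \<Sum>a\<in>UNIV. h a z * C a z)"
  proof
    fix z
    have "?H z = (\<Sum>j\<in>UNIV. \<Sum>a\<in>UNIV. b $ j * N j a z * C a z)"
      by (simp add: Ct_eq sum_distrib_left mult.assoc)
    also have "\<dots> = (\<Sum>a\<in>UNIV. \<Sum>j\<in>UNIV. b $ j * N j a z * C a z)"
      by (rule sum.swap)
    finally show "?H z = (\<Sum>a\<in>UNIV. h a z * C a z)"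
      by (simp add: h_def sum_distrib_right)
  qed
  \<comment> \<open>Coefficients of the linear system
    \<open>{H, C\<^sub>m} = \<Sum> g\<^sub>m\<^sub>c C\<^sub>c\<close>: the first class relations
    give the sum, and differentiating \<open>h\<close> gives the second term.\<close>
  define g where "g m c = (\<lambda>z. (\<Sum>a\<in>UNIV. h a z * f a m c z) + lb (h c) (C m) z)" for m c
  have g: "g m c \<in> S" for m c
    unfolding g_def by (intro S_intros in_S h lb_smooth)
  have H_C: "lb ?H (C m) z = (\<Sum>c\<in>UNIV. g m c z * C c z)" if z: "z \<in> U" for m z
  proof -
    have "lb ?H (C m) z =
        (\<Sum>a\<in>UNIV. h a z * (\<Sum>c\<in>UNIV. f a m c z * C c z) + lb (h a) (C m) z * C a z)"
      unfolding H_eq by (subst lb_combination_left) (simp_all add: z h in_S lb_C)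
    also have "\<dots> = (\<Sum>a\<in>UNIV. \<Sum>c\<in>UNIV. h a z * f a m c z * C c z) +
        (\<Sum>c\<in>UNIV. lb (h c) (C m) z * C c z)"
      by (simp add: sum.distrib sum_distrib_left mult.assoc)
    also have "(\<Sum>a\<in>UNIV. \<Sum>c\<in>UNIV. h a z * f a m c z * C c z) =
        (\<Sum>c\<in>UNIV. (\<Sum>a\<in>UNIV. h a z * f a m c z) * C c z)"
      by (subst sum.swap) (simp add: sum_distrib_right)
    finally show ?thesis
      by (simp add: g_def distrib_right sum.distrib)
  qed
  \<comment> \<open>Terms in which \<open>h\<close> is differentiated carry a factor
    \<open>C\<close> and vanish on the constraint surface; what is left is
    \<open>\<beta> N \<alpha> = \<beta>\<close>.\<close>
  have H_T: "lb ?H (T k) z = b $ k" if z: "z \<in> U" and "\<And>m. C m z = 0" for z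
  proof -
    have "lb ?H (T k) z = (\<Sum>a\<in>UNIV. h a z * \<alpha> a k z)"
      unfolding H_eq
      by (subst lb_combination_left) (simp_all add: that h in_S lb_global C T \<alpha>_def)
    also have "\<dots> = (\<Sum>j\<in>UNIV. \<Sum>a\<in>UNIV. b $ j * (N j a z * \<alpha> a k z))"
      by (subst sum.swap) (simp add: h_def sum_distrib_right mult.assoc)
    also have "\<dots> = (\<Sum>j\<in>UNIV. b $ j * (if j = k then 1 else 0))"
      by (simp only: N_\<alpha>[OF z] flip: sum_distrib_left)
    also have "\<dots> = b $ k"
      by (simp add: if_distrib[of "\<lambda>u. _ * u"] cong: if_cong)
    finally show ?thesis .
  qed
  obtain \<gamma> where \<gamma>: "integral_curve A br U ?H {0..1} \<gamma>" "\<gamma> 0 = x" "\<gamma> 1 = y"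
    using flow by (auto simp: ham_flow_def closed_segment_eq_real_ivl)
  have \<gamma>U: "\<gamma> t \<in> U" if "t \<in> {0..1}" for t
    using \<gamma>(1) that by (auto simp: integral_curve_def)
  have deriv: "((\<lambda>s. F (\<gamma> s)) has_real_derivative lb ?H F (\<gamma> t)) (at t within {0..1})"
    if "F \<in> S" "t \<in> {0..1}" for F t
    using \<gamma>(1) that unfolding integral_curve_def ham_vf_def by blast
  \<comment> \<open>Along the curve the constraints solve a homogeneous linear system with zero
    initial data, so the curve never leaves the constraint surface and \<open>H_T\<close> holds at
    every time.\<close>
  have C0: "C m (\<gamma> t) = 0" if t: "t \<in> {0..1}" for m t
  proof (rule linear_ode_zero[where u="\<lambda>m t. C m (\<gamma> t)" and g="\<lambda>m c t. g m c (\<gamma> t)" and T=1])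
    show "((\<lambda>t. C m (\<gamma> t)) has_real_derivative (\<Sum>c\<in>UNIV. g m c (\<gamma> t) * C c (\<gamma> t)))
        (at t within {0..1})" if "t \<in> {0..1}" for m t
      using deriv[OF in_S(2) that, of m] by (simp only: H_C[OF \<gamma>U[OF that]])
    show "continuous_on {0..1} (\<lambda>t. g m c (\<gamma> t))" for m c
      using \<gamma>(1) by (intro continuous_on_compose2[OF smooth_funs_continuous[OF open_U g]])
        (auto simp: integral_curve_def)
    show "C m (\<gamma> 0) = 0" for m
      using x \<gamma>(2) by (simp add: constraint_surface_def)
  qed (rule t)
  \<comment> \<open>The derivative is the constant \<open>b $ k\<close>, so the mean value theorem
    gives the exact increment whatever the intermediate point.\<close>
  have "\<exists>t\<in>{0..1::real}. T k (\<gamma> 1) - T k (\<gamma> 0) = b $ k * (1 - 0)"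
  proof (rule mvt_very_simple[where f="\<lambda>s. T k (\<gamma> s)" and f'="\<lambda>_. (*) (b $ k)"])
    show "((\<lambda>s. T k (\<gamma> s)) has_derivative (*) (b $ k)) (at t within {0..1})"
      if "0 \<le> t" "t \<le> 1" for t
      using deriv[OF in_S(3), of t k] H_T[OF \<gamma>U C0, of t] that
      by (simp add: has_field_derivative_def)
  qed simp
  then show ?thesis using \<gamma>(2,3) by auto
qed

end

theorem mainTheorem6:
  fixes A :: "('a::{t2_space, second_countable_topology}, 'e::euclidean_space) chart set"
    and br :: "('a \<Rightarrow> real) \<Rightarrow> ('a \<Rightarrow> real) \<Rightarrow> 'a \<Rightarrow> real"
    and C T Ct :: "'n::finite \<Rightarrow> 'a \<Rightarrow> real"
    and U :: "'a set"
    and p :: nat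
  assumes "smooth_manifold A" and "DIM('e) = 2 * p"
    and "poisson_bracket A br" and "nondegenerate A br"
    and "CARD('n) < p"
    and "\<And>i. C i \<in> smooth_funs A UNIV"
    and "independent_constraints A C"
    and "first_class A br C"
    and "\<And>k. T k \<in> smooth_funs A UNIV"
    and "open U" and "constraint_surface C \<subseteq> U"
    and "\<And>x. x \<in> U \<Longrightarrow> invertible (clock_matrix br C T x)"
    and Ct: "Ct = new_constraint br C T"
  shows "(\<exists>c. (\<forall>m j k l. c m j k l \<in> smooth_funs A U) \<and>
            (\<forall>m j. \<forall>x\<in>U. local_bracket A br (Ct m) (Ct j) x =
               (\<Sum>k\<in>UNIV. \<Sum>l\<in>UNIV. c m j k l x * Ct k x * Ct l x))) \<and>
         (\<forall>(\<beta> :: real^'n) x y k. x \<in> constraint_surface C \<and>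
            ham_flow A br U (\<lambda>z. \<Sum>j\<in>UNIV. \<beta> $ j * Ct j z) 1 x y \<longrightarrow>
            T k y = T k x + \<beta> $ k)"
proof -
  obtain f where f: "\<And>i j k. f i j k \<in> smooth_funs A UNIV"
    "\<And>i j x. br (C i) (C j) x = (\<Sum>k\<in>UNIV. f i j k x * C k x)"
    using assms(8) unfolding first_class_def by metis
  interpret clock_constraints A br U C T f
    by unfold_locales (use assms f in auto)
  show ?thesis
    \<comment> \<open>The witness for the coefficients \<open>c\<close> is
      \<open>structure_fun\<close>, built from the structure functions \<open>f\<close> obtained
      above.\<close>
    unfolding Ct using structure_fun_smooth weakly_abelian clock_evolution by blast
qed

end
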